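(* Let $A$ be a commutative $\mathbf{Q}$-algebra, let $k\ge 1$ and $p_1,\dots,p_k\ge1$ be integers, let $H=x_1^{p_1}+\cdots+x_k^{p_k}-1\in A[x_1,\dots,x_k]$ and $C=A[x_1,\dots,x_k]/(H)$. Let $\Omega=\Omega_{C/A}$ be the module of Kähler differentials with universal derivation $d:C\to\Omega$, and let $w_i=\overline{dx_i}\in\Omega$ for $i=1,\dots,k$. Let $F$ be the free $C$-module on $e_1,\dots,e_k$, let $G=p_1x_1^{p_1-1}e_1+\cdots+p_kx_k^{p_k-1}e_k\in F$, let $s:\Omega\to F$ be the $C$-linear map with $s(\overline{dx_i})=e_i-\frac1{p_i}x_iG$, and let $\xi_i=e_i^*\circ s:\Omega\to C$, where $e_i^*:F\to C$ is the $i$-th coordinate function. Then the map \[\nabla:\Omega\to\Omega\otimes_C\Omega,\qquad \nabla(w)=\sum_{i=1}^k d(\xi_i(w))\otimes w_i\] is a connection on $\Omega$.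
   Context: There is an isomorphism $\Omega\cong C\{dx_1,\dots,dx_k\}/(dH)$ with $dH=p_1x_1^{p_1-1}dx_1+\cdots+p_kx_k^{p_k-1}dx_k$; $\overline{dx_i}$ denotes the class of $dx_i$. A map $\nabla:\Omega\to\Omega\otimes_C\Omega$ is a connection if it is additive and $\nabla(cw)=c\nabla(w)+d(c)\otimes w$ for all $c\in C$, $w\in\Omega$. *)

theory Defs
  imports "HOL-Algebra.Algebraic_Closure_Type" "HOL-Algebra.Indexed_Polynomials"
    "HOL-Algebra.QuotRing" "HOL-Algebra.Module"
begin

section \<open>Multivariate polynomial rings\<close>

text \<open>
  Carrier, addition, constants and variables are those of
  \<^theory>\<open>HOL-Algebra.Indexed_Polynomials\<close>: a polynomial is the coefficient function on monomials,
  and a monomial is a multiset of variables. That theory has no product of two polynomials; it is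
  added here as the convolution product.
\<close>

definition mpoly_mult ::
    "('a, 'm) ring_scheme \<Rightarrow> ('i multiset \<Rightarrow> 'a) \<Rightarrow> ('i multiset \<Rightarrow> 'a) \<Rightarrow> ('i multiset \<Rightarrow> 'a)" where
  "mpoly_mult A f g = (\<lambda>m. \<Oplus>\<^bsub>A\<^esub>a\<in>{a. a \<subseteq># m}. f a \<otimes>\<^bsub>A\<^esub> g (m - a))"

definition mpoly_ring :: "('a, 'm) ring_scheme \<Rightarrow> 'i set \<Rightarrow> ('i multiset \<Rightarrow> 'a) ring" where
  "mpoly_ring A I =
     \<lparr>carrier = ring.indexed_pset A I (carrier A),
      monoid.mult = mpoly_mult A,
      one = ring.indexed_const A \<one>\<^bsub>A\<^esub>,
      ring.zero = ring.indexed_const A \<zero>\<^bsub>A\<^esub>,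
      add = ring.indexed_padd A\<rparr>"


section \<open>Modules\<close>

text \<open>
  The record type \<open>module\<close> extends \<open>ring\<close>. The fields \<open>mult\<close> and \<open>one\<close> have no meaning for a module
  and are left \<open>undefined\<close> below.
\<close>

definition module_homs ::
    "('r, 'x) ring_scheme \<Rightarrow> ('r, 'a, 'y) module_scheme \<Rightarrow> ('r, 'b, 'z) module_scheme \<Rightarrow> ('a \<Rightarrow> 'b) set"
  where
  "module_homs R M N =
     {f \<in> carrier M \<rightarrow>\<^sub>E carrier N.
        (\<forall>u\<in>carrier M. \<forall>v\<in>carrier M. f (u \<oplus>\<^bsub>M\<^esub> v) = f u \<oplus>\<^bsub>N\<^esub> f v) \<and>
        (\<forall>c\<in>carrier R. \<forall>u\<in>carrier M. f (c \<odot>\<^bsub>M\<^esub> u) = c \<odot>\<^bsub>N\<^esub> f u)}"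

definition submodule_span ::
    "('r, 'x) ring_scheme \<Rightarrow> ('r, 'a, 'y) module_scheme \<Rightarrow> 'a set \<Rightarrow> 'a set" where
  "submodule_span R M S = \<Inter>{N. submodule N R M \<and> S \<subseteq> N}"

definition quot_module :: "('r, 'a, 'y) module_scheme \<Rightarrow> 'a set \<Rightarrow> ('r, 'a set) module" where
  "quot_module M N =
     \<lparr>carrier = a_rcosets\<^bsub>M\<^esub> N, monoid.mult = undefined, one = undefined,
      ring.zero = N, add = set_add M,
      module.smult = (\<lambda>c U. \<Union>u\<in>U. N +>\<^bsub>M\<^esub> (c \<odot>\<^bsub>M\<^esub> u))\<rparr>"

text \<open>The free module on a set \<open>S\<close>: finitely supported functions on \<open>S\<close>, extended by zero.\<close>

definition free_module :: "('r, 'x) ring_scheme \<Rightarrow> 's set \<Rightarrow> ('r, 's \<Rightarrow> 'r) module" where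
  "free_module R S =
     \<lparr>carrier = {f. (\<forall>t\<in>S. f t \<in> carrier R) \<and> (\<forall>t. t \<notin> S \<longrightarrow> f t = \<zero>\<^bsub>R\<^esub>) \<and> finite {t. f t \<noteq> \<zero>\<^bsub>R\<^esub>}},
      monoid.mult = undefined, one = undefined,
      ring.zero = (\<lambda>t. \<zero>\<^bsub>R\<^esub>), add = (\<lambda>f g t. f t \<oplus>\<^bsub>R\<^esub> g t),
      module.smult = (\<lambda>c f t. c \<otimes>\<^bsub>R\<^esub> f t)\<rparr>"

definition free_basis :: "('r, 'x) ring_scheme \<Rightarrow> 's \<Rightarrow> 's \<Rightarrow> 'r" where
  "free_basis R t = (\<lambda>u. if u = t then \<one>\<^bsub>R\<^esub> else \<zero>\<^bsub>R\<^esub>)"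


subsection \<open>Tensor products\<close>

definition tensor_free ::
    "('r, 'x) ring_scheme \<Rightarrow> ('r, 'a, 'y) module_scheme \<Rightarrow> ('r, 'b, 'z) module_scheme
      \<Rightarrow> ('r, 'a \<times> 'b \<Rightarrow> 'r) module" where
  "tensor_free R M N = free_module R (carrier M \<times> carrier N)"

definition tensor_relations ::
    "('r, 'x) ring_scheme \<Rightarrow> ('r, 'a, 'y) module_scheme \<Rightarrow> ('r, 'b, 'z) module_scheme
      \<Rightarrow> ('a \<times> 'b \<Rightarrow> 'r) set" where
  "tensor_relations R M N =
     (let L = tensor_free R M N; \<beta> = free_basis R in submodule_span R L
       ({\<beta> (u \<oplus>\<^bsub>M\<^esub> u', v) \<ominus>\<^bsub>L\<^esub> (\<beta> (u, v) \<oplus>\<^bsub>L\<^esub> \<beta> (u', v)) | u u' v.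
           u \<in> carrier M \<and> u' \<in> carrier M \<and> v \<in> carrier N} \<union>
        {\<beta> (u, v \<oplus>\<^bsub>N\<^esub> v') \<ominus>\<^bsub>L\<^esub> (\<beta> (u, v) \<oplus>\<^bsub>L\<^esub> \<beta> (u, v')) | u v v'.
           u \<in> carrier M \<and> v \<in> carrier N \<and> v' \<in> carrier N} \<union>
        {\<beta> (c \<odot>\<^bsub>M\<^esub> u, v) \<ominus>\<^bsub>L\<^esub> c \<odot>\<^bsub>L\<^esub> \<beta> (u, v) | c u v.
           c \<in> carrier R \<and> u \<in> carrier M \<and> v \<in> carrier N} \<union>
        {\<beta> (u, c \<odot>\<^bsub>N\<^esub> v) \<ominus>\<^bsub>L\<^esub> c \<odot>\<^bsub>L\<^esub> \<beta> (u, v) | c u v.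
           c \<in> carrier R \<and> u \<in> carrier M \<and> v \<in> carrier N}))"

definition tensor_module ::
    "('r, 'x) ring_scheme \<Rightarrow> ('r, 'a, 'y) module_scheme \<Rightarrow> ('r, 'b, 'z) module_scheme
      \<Rightarrow> ('r, ('a \<times> 'b \<Rightarrow> 'r) set) module" where
  "tensor_module R M N = quot_module (tensor_free R M N) (tensor_relations R M N)"

definition pure_tensor ::
    "('r, 'x) ring_scheme \<Rightarrow> ('r, 'a, 'y) module_scheme \<Rightarrow> ('r, 'b, 'z) module_scheme
      \<Rightarrow> 'a \<Rightarrow> 'b \<Rightarrow> ('a \<times> 'b \<Rightarrow> 'r) set" where
  "pure_tensor R M N u v = tensor_relations R M N +>\<^bsub>tensor_free R M N\<^esub> free_basis R (u, v)"


subsection \<open>Kaehler differentials\<close>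

text \<open>
  For a ring homomorphism \<open>\<phi>\<close> from \<open>A\<close> to \<open>C\<close>: the \<open>C\<close>-module on symbols \<open>d c\<close>, for \<open>c\<close> in \<open>C\<close>, subject
  to additivity, the Leibniz rule, and \<open>d (\<phi> a) = 0\<close> for \<open>a\<close> in \<open>A\<close>.
\<close>

definition kaehler_free :: "('c, 'x) ring_scheme \<Rightarrow> ('c, 'c \<Rightarrow> 'c) module" where
  "kaehler_free C = free_module C (carrier C)"

definition kaehler_relations ::
    "('a, 'm) ring_scheme \<Rightarrow> ('c, 'x) ring_scheme \<Rightarrow> ('a \<Rightarrow> 'c) \<Rightarrow> ('c \<Rightarrow> 'c) set" where
  "kaehler_relations A C \<phi> =
     (let L = kaehler_free C; \<beta> = free_basis C in submodule_span C L
       ({\<beta> (b \<oplus>\<^bsub>C\<^esub> c) \<ominus>\<^bsub>L\<^esub> (\<beta> b \<oplus>\<^bsub>L\<^esub> \<beta> c) | b c. b \<in> carrier C \<and> c \<in> carrier C} \<union>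
        {\<beta> (b \<otimes>\<^bsub>C\<^esub> c) \<ominus>\<^bsub>L\<^esub> (b \<odot>\<^bsub>L\<^esub> \<beta> c \<oplus>\<^bsub>L\<^esub> c \<odot>\<^bsub>L\<^esub> \<beta> b) | b c. b \<in> carrier C \<and> c \<in> carrier C} \<union>
        {\<beta> (\<phi> a) | a. a \<in> carrier A}))"

definition kaehler ::
    "('a, 'm) ring_scheme \<Rightarrow> ('c, 'x) ring_scheme \<Rightarrow> ('a \<Rightarrow> 'c) \<Rightarrow> ('c, ('c \<Rightarrow> 'c) set) module" where
  "kaehler A C \<phi> = quot_module (kaehler_free C) (kaehler_relations A C \<phi>)"

definition kaehler_d ::
    "('a, 'm) ring_scheme \<Rightarrow> ('c, 'x) ring_scheme \<Rightarrow> ('a \<Rightarrow> 'c) \<Rightarrow> 'c \<Rightarrow> ('c \<Rightarrow> 'c) set" where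
  "kaehler_d A C \<phi> c = kaehler_relations A C \<phi> +>\<^bsub>kaehler_free C\<^esub> free_basis C c"


subsection \<open>Connections\<close>

definition is_connection ::
    "('c, 'x) ring_scheme \<Rightarrow> ('c, 'w, 'y) module_scheme \<Rightarrow> ('c \<Rightarrow> 'w)
      \<Rightarrow> ('w \<Rightarrow> ('w \<times> 'w \<Rightarrow> 'c) set) \<Rightarrow> bool" where
  "is_connection C \<Omega> d nab \<longleftrightarrow>
     (let T = tensor_module C \<Omega> \<Omega> in
       nab \<in> carrier \<Omega> \<rightarrow> carrier T \<and>
       (\<forall>u\<in>carrier \<Omega>. \<forall>v\<in>carrier \<Omega>. nab (u \<oplus>\<^bsub>\<Omega>\<^esub> v) = nab u \<oplus>\<^bsub>T\<^esub> nab v) \<and>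
       (\<forall>c\<in>carrier C. \<forall>u\<in>carrier \<Omega>.
          nab (c \<odot>\<^bsub>\<Omega>\<^esub> u) = c \<odot>\<^bsub>T\<^esub> nab u \<oplus>\<^bsub>T\<^esub> pure_tensor C \<Omega> \<Omega> (d c) u))"

end

(*
  The derivation P -> F of the polynomial ring that sends x_i to t_i = e_i - (1/p_i) x_i G sends H to
  G - (x_1^p_1 + ... + x_k^p_k) G = 0 in F, hence factors through C and induces s. Conversely the
  classes w_i generate Omega, so s is unique. The map r : F -> Omega with r(e_i) = w_i sends G to
  dH = 0, so r(s(w_i)) = w_i and r o s is the identity, that is, w = sum_i xi_i(w) w_i for all w.
  The Leibniz rule of nabla is then the Leibniz rule of d applied to the products c xi_i(w).
*)
theory Submission
  imports Defs
begin

section \<open>The ring of multivariate polynomials\<close>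

text \<open>The coefficients x_i/p_i come from Euler's identity. The functional on F with e_i ->
  x_i/p_i takes the value sum_i x_i^p_i = 1 at G, so e_i -> e_i - (x_i/p_i) G is the projection of F
  that kills exactly the multiples of G. It makes \<Omega> = F/(G) a direct summand of F, and nabla
  is the connection that \<Omega> inherits from the coefficientwise d on F. Neither the functional
  nor the isomorphism with F/(G) is constructed. Two of its consequences suffice: the w_i satisfy
  the relation given by dH, and they generate \<Omega>. Generation comes from the formula D f =
  sum_j q(df/dx_j) D(x_j), valid for every derivation D along q : P -> C that vanishes on constants.
  Read as a definition, the same formula produces the derivation that induces s. Since d is not
  C-linear, d(c xi_i(w)) has the surplus term xi_i(w) dc. After tensoring with w_i its scalar
  xi_i(w) crosses the tensor sign, and the surplus terms add up to dc tensor w.\<close>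

lemma finite_submultisets: "finite {a. a \<subseteq># m}"
proof (rule finite_subset)
  \<comment> \<open>A submultiset of m is the multiset of a list with entries in the finite set of
    elements of m and of length at most the size of m. There are finitely many such lists.\<close>
  show "{a. a \<subseteq># m} \<subseteq> (\<lambda>s. mset s) ` {s. set s \<subseteq> set_mset m \<and> length s \<le> size m}"
  proof
    fix a assume "a \<in> {a. a \<subseteq># m}"
    then have "a \<subseteq># m" by simp
    obtain s where "mset s = a" using ex_mset by blast
    then show "a \<in> (\<lambda>s. mset s) ` {s. set s \<subseteq> set_mset m \<and> length s \<le> size m}"
      using \<open>a \<subseteq># m\<close> set_mset_mono size_mset_mono by fastforce
  qed
  show "finite ((\<lambda>s. mset s) ` {s. set s \<subseteq> set_mset m \<and> length s \<le> size m})"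
    by (intro finite_imageI finite_lists_length_le) simp
qed

section \<open>Convolution product of polynomials and the ring axioms\<close>

context cring
begin

lemma mpoly_mult_closed:
  assumes "carrier_coeff f" "carrier_coeff g"
  shows "carrier_coeff (mpoly_mult R f g)"
  using assms unfolding carrier_coeff_def mpoly_mult_def by (auto intro!: finsum_closed)

text \<open>The substitution of m - a for a is an involution on the submultisets of m and exchanges
  the two arguments of the convolution.\<close>

lemma mpoly_mult_comm:
  fixes f g :: "'c multiset \<Rightarrow> 'a"
  assumes "carrier_coeff f" "carrier_coeff g"
  shows "mpoly_mult R f g = mpoly_mult R g f"
proof
  fix m :: "'c multiset"
  note [simp] = carrier_coeffE[OF assms(1)] carrier_coeffE[OF assms(2)]
  have inj: "inj_on (\<lambda>a. m - a) {a. a \<subseteq># m}"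
    by (rule inj_on_inverseI[where g = "\<lambda>a. m - a"]) (auto simp: subset_mset.diff_diff_right)
  have img: "(\<lambda>a. m - a) ` {a. a \<subseteq># m} = {a. a \<subseteq># m}"
  proof (intro equalityI subsetI)
    fix a assume "a \<in> {a. a \<subseteq># m}"
    then have "a = m - (m - a)" by (simp add: subset_mset.diff_diff_right)
    then show "a \<in> (\<lambda>a. m - a) ` {a. a \<subseteq># m}" by (rule image_eqI) simp
  qed auto
  have "mpoly_mult R f g m = (\<Oplus>a\<in>(\<lambda>a. m - a) ` {a. a \<subseteq># m}. f a \<otimes> g (m - a))"
    by (simp only: img mpoly_mult_def)
  also have "\<dots> = (\<Oplus>a\<in>{a. a \<subseteq># m}. f (m - a) \<otimes> g (m - (m - a)))"
    by (intro finsum_reindex inj) simp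
  also have "\<dots> = mpoly_mult R g f m"
    unfolding mpoly_mult_def
    by (intro add.finprod_cong') (auto simp: m_comm subset_mset.diff_diff_right)
  finally show "mpoly_mult R f g m = mpoly_mult R g f m" .
qed

text \<open>Together with \<open>mpoly_mult_add\<close> and \<open>mpoly_mult_pmult\<close> this
  computes a product by recursion on the left factor along the generators of
  \<open>indexed_pset\<close>. Closure and associativity then become inductions, and no double sum
  has to be rearranged.\<close>

lemma mpoly_mult_const:
  assumes "a \<in> carrier R" "carrier_coeff f"
  shows "mpoly_mult R (indexed_const a) f = (\<lambda>m. a \<otimes> f m)"
proof
  fix m
  note [simp] = carrier_coeffE[OF assms(2)]
  have "mpoly_mult R (indexed_const a) f m
      = (\<Oplus>b\<in>{b. b \<subseteq># m}. if {#} = b then a \<otimes> f (m - b) else \<zero>)"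
    unfolding mpoly_mult_def indexed_const_def
    by (intro add.finprod_cong') (auto simp: assms)
  also have "\<dots> = a \<otimes> f (m - {#})"
    by (intro finsum_singleton) (auto simp: assms finite_submultisets)
  finally show "mpoly_mult R (indexed_const a) f m = a \<otimes> f m" by simp
qed

lemma mpoly_mult_add:
  assumes "carrier_coeff f" "carrier_coeff g" "carrier_coeff h"
  shows "mpoly_mult R (indexed_padd f g) h = indexed_padd (mpoly_mult R f h) (mpoly_mult R g h)"
proof
  fix m
  note [simp] = assms[THEN carrier_coeffE]
  show "mpoly_mult R (indexed_padd f g) h m = indexed_padd (mpoly_mult R f h) (mpoly_mult R g h) m"
    unfolding mpoly_mult_def indexed_padd_def
    by (subst add.finprod_multf[symmetric, simplified]) (auto simp: l_distr)
qed

text \<open>Only submultisets of m that contain i contribute. If i occurs in m they are exactly the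
  \<open>add_mset i a\<close> with a below m minus one i, so the sum is reindexed along the
  injection \<open>add_mset i\<close>; if i does not occur in m there are none.\<close>

lemma mpoly_mult_pmult:
  assumes "carrier_coeff f" "carrier_coeff g"
  shows "mpoly_mult R (indexed_pmult f i) g = indexed_pmult (mpoly_mult R f g) i"
proof
  fix m
  note [simp] = assms[THEN carrier_coeffE]
  show "mpoly_mult R (indexed_pmult f i) g m = indexed_pmult (mpoly_mult R f g) i m"
  proof (cases "i \<in># m")
    case False
    have "(\<Oplus>a\<in>{a. a \<subseteq># m}. (if i \<in># a then f (a - {#i#}) else \<zero>) \<otimes> g (m - a)) = \<zero>"
      using False by (intro add.finprod_one_eqI[simplified]) (auto dest: mset_subset_eqD)
    then show ?thesis using False by (simp add: mpoly_mult_def indexed_pmult_def)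
  next
    case True
    then obtain n where m: "m = add_mset i n" by (metis insert_DiffM)
    have inj: "inj_on (add_mset i) {a. a \<subseteq># n}" by (rule inj_onI) simp
    have "mpoly_mult R (indexed_pmult f i) g m
        = (\<Oplus>a\<in>{a. a \<subseteq># m}. (if i \<in># a then f (a - {#i#}) else \<zero>) \<otimes> g (m - a))"
      by (simp add: mpoly_mult_def indexed_pmult_def)
    also have "\<dots> = (\<Oplus>a\<in>add_mset i ` {a. a \<subseteq># n}.
                        (if i \<in># a then f (a - {#i#}) else \<zero>) \<otimes> g (m - a))"
    proof (rule add.finprod_mono_neutral_cong_right)
      show "finite {a. a \<subseteq># m}" by (rule finite_submultisets)
      show "add_mset i ` {a. a \<subseteq># n} \<subseteq> {a. a \<subseteq># m}" by (auto simp: m)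
      show "(if i \<in># a then f (a - {#i#}) else \<zero>) \<otimes> g (m - a) = \<zero>"
        if "a \<in> {a. a \<subseteq># m} - add_mset i ` {a. a \<subseteq># n}" for a
      proof -
        have "i \<notin># a"
        proof
          assume "i \<in># a"
          then obtain b where "a = add_mset i b" by (metis insert_DiffM)
          with that show False by (auto simp: m)
        qed
        then show ?thesis by simp
      qed
    qed auto
    also have "\<dots> = (\<Oplus>a\<in>{a. a \<subseteq># n}.
          (if i \<in># add_mset i a then f (add_mset i a - {#i#}) else \<zero>) \<otimes> g (m - add_mset i a))"
      by (rule finsum_reindex[OF _ inj]) auto
    also have "\<dots> = mpoly_mult R f g n"
      by (simp add: mpoly_mult_def m)
    finally show ?thesis by (simp add: indexed_pmult_def m)
  qed
qed

lemma mpoly_ring_simps: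
  "carrier (mpoly_ring R I) = indexed_pset I (carrier R)"
  "f \<otimes>\<^bsub>mpoly_ring R I\<^esub> g = mpoly_mult R f g"
  "\<one>\<^bsub>mpoly_ring R I\<^esub> = indexed_const \<one>"
  "\<zero>\<^bsub>mpoly_ring R I\<^esub> = indexed_const \<zero>"
  "f \<oplus>\<^bsub>mpoly_ring R I\<^esub> g = indexed_padd f g"
  by (simp_all add: mpoly_ring_def)

lemma indexed_pset_coeff: "f \<in> indexed_pset I (carrier R) \<Longrightarrow> carrier_coeff f"
  by (rule indexed_pset_in_carrier) auto

lemma carrier_coeff_const: "a \<in> carrier R \<Longrightarrow> carrier_coeff (indexed_const a)"
  by (auto simp: carrier_coeff_def indexed_const_def)

text \<open>The constant case of closure under products. With the scalar -1 it also provides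
  negatives, for which \<open>indexed_pset\<close> has no generating rule.\<close>

lemma indexed_pset_smult:
  fixes f :: "'c multiset \<Rightarrow> 'a"
  assumes "a \<in> carrier R" "f \<in> indexed_pset I (carrier R)"
  shows "(\<lambda>m. a \<otimes> f m) \<in> indexed_pset I (carrier R)"
  using assms(2)
proof induction
  case (indexed_const k)
  have "(\<lambda>m :: 'c multiset. a \<otimes> indexed_const k m) = indexed_const (a \<otimes> k)"
    using assms(1) by (auto simp: indexed_const_def)
  then show ?case using indexed_const assms(1) by (simp add: indexed_pset.indexed_const)
next
  case (indexed_padd f g)
  have "(\<lambda>m. a \<otimes> indexed_padd f g m) = indexed_padd (\<lambda>m. a \<otimes> f m) (\<lambda>m. a \<otimes> g m)"
    using indexed_padd.hyps[THEN indexed_pset_coeff] assms(1)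
    by (auto simp: indexed_padd_def r_distr carrier_coeff_def)
  then show ?case using indexed_padd by (simp add: indexed_pset.indexed_padd)
next
  case (indexed_pmult f i)
  have "(\<lambda>m. a \<otimes> indexed_pmult f i m) = indexed_pmult (\<lambda>m. a \<otimes> f m) i"
    using assms(1) by (auto simp: indexed_pmult_def)
  then show ?case using indexed_pmult by (simp add: indexed_pset.indexed_pmult)
qed

lemma indexed_pset_mult:
  assumes "f \<in> indexed_pset I (carrier R)" "g \<in> indexed_pset I (carrier R)"
  shows "mpoly_mult R f g \<in> indexed_pset I (carrier R)"
  using assms(1)
proof induction
  case (indexed_const k)
  then show ?case
    using assms(2) by (simp add: mpoly_mult_const indexed_pset_coeff indexed_pset_smult)
next
  case (indexed_padd f h)
  then show ?case
    using assms(2) by (simp add: mpoly_mult_add indexed_pset_coeff indexed_pset.indexed_padd)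
next
  case (indexed_pmult f i)
  then show ?case
    using assms(2) by (simp add: mpoly_mult_pmult indexed_pset_coeff indexed_pset.indexed_pmult)
qed

text \<open>Induction on the leftmost factor. Sums and multiplication by a variable pass through
  both bracketings alike, and for a constant the scalar is pulled out of the convolution of g and
  h.\<close>

lemma mpoly_mult_assoc:
  assumes "f \<in> indexed_pset I (carrier R)" "carrier_coeff g" "carrier_coeff h"
  shows "mpoly_mult R (mpoly_mult R f g) h = mpoly_mult R f (mpoly_mult R g h)"
  using assms(1)
proof induction
  case (indexed_const k)
  note [simp] = assms(2,3)[THEN carrier_coeffE]
  have "carrier_coeff (\<lambda>m. k \<otimes> g m)"
    using indexed_const assms(2) by (simp add: carrier_coeff_def)
  moreover have "mpoly_mult R (\<lambda>m. k \<otimes> g m) h = (\<lambda>m. k \<otimes> mpoly_mult R g h m)"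
    unfolding mpoly_mult_def using indexed_const
    by (subst finsum_rdistr) (auto simp: m_assoc finite_submultisets)
  ultimately show ?case
    using indexed_const assms(2,3) by (simp add: mpoly_mult_const mpoly_mult_closed)
next
  case (indexed_padd f f')
  then show ?case
    using assms(2,3) by (simp add: mpoly_mult_add indexed_pset_coeff mpoly_mult_closed)
next
  case (indexed_pmult f i)
  then show ?case
    using assms(2,3) by (simp add: mpoly_mult_pmult indexed_pset_coeff mpoly_mult_closed)
qed

lemma indexed_pset_neg:
  assumes "f \<in> indexed_pset I (carrier R)"
  shows "\<exists>g\<in>indexed_pset I (carrier R). indexed_padd g f = indexed_const \<zero>"
proof (intro bexI)
  show "indexed_padd (\<lambda>m. \<ominus> \<one> \<otimes> f m) f = indexed_const \<zero>"
    using indexed_pset_coeff[OF assms]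
    by (auto simp: indexed_padd_def indexed_zero_def carrier_coeff_def l_minus l_neg)
qed (use assms in \<open>simp add: indexed_pset_smult\<close>)

lemma cring_mpoly_ring: "cring (mpoly_ring R I)"
proof (rule cringI)
  show "abelian_group (mpoly_ring R I)"
    by (rule abelian_groupI)
      (simp_all add: mpoly_ring_simps indexed_pset.intros indexed_pset_neg,
        auto dest!: indexed_pset_coeff
          simp: indexed_padd_def indexed_const_def carrier_coeff_def a_ac)
  show "comm_monoid (mpoly_ring R I)"
    by (rule comm_monoidI)
      (simp_all add: mpoly_ring_simps indexed_pset.intros indexed_pset_mult indexed_pset_coeff
        mpoly_mult_assoc mpoly_mult_const, auto dest!: indexed_pset_coeff
          simp: carrier_coeff_def mpoly_mult_comm)
qed (simp add: mpoly_ring_simps mpoly_mult_add indexed_pset_coeff)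

section \<open>Variables and constants as ring elements, and induction over the ring
  operations\<close>

lemma indexed_var_closed: "i \<in> I \<Longrightarrow> indexed_var i \<in> carrier (mpoly_ring R I)"
  by (simp add: mpoly_ring_simps indexed_var_def indexed_pset.intros)

lemma indexed_const_closed: "a \<in> carrier R \<Longrightarrow> indexed_const a \<in> carrier (mpoly_ring R I)"
  by (simp add: mpoly_ring_simps indexed_pset.intros)

text \<open>Translates the primitive shift of monomials into a ring product, so that later proofs
  can use ring laws in place of coefficients.\<close>

lemma indexed_pmult_eq_var_mult:
  assumes "f \<in> carrier (mpoly_ring R I)"
  shows "indexed_pmult f i = indexed_var i \<otimes>\<^bsub>mpoly_ring R I\<^esub> f"
proof -
  have "carrier_coeff f" using assms by (simp add: mpoly_ring_simps indexed_pset_coeff)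
  then have "mpoly_mult R (indexed_const \<one>) f = f"
    by (simp add: mpoly_mult_const carrier_coeff_def)
  then show ?thesis
    using \<open>carrier_coeff f\<close>
    by (simp add: mpoly_ring_simps indexed_var_def mpoly_mult_pmult carrier_coeff_const)
qed

text \<open>The generation of \<open>indexed_pset\<close> expressed with the operations of the ring.
  The product rule and the formula for derivations are both proved by it.\<close>

lemma mpoly_ring_induct [consumes 1, case_names const add var_mult]:
  assumes "f \<in> carrier (mpoly_ring R I)"
    and "\<And>a. a \<in> carrier R \<Longrightarrow> Q (indexed_const a)"
    and "\<And>f g. \<lbrakk>f \<in> carrier (mpoly_ring R I); g \<in> carrier (mpoly_ring R I); Q f; Q g\<rbrakk>
      \<Longrightarrow> Q (f \<oplus>\<^bsub>mpoly_ring R I\<^esub> g)"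
    and "\<And>f i. \<lbrakk>f \<in> carrier (mpoly_ring R I); i \<in> I; Q f\<rbrakk>
      \<Longrightarrow> Q (indexed_var i \<otimes>\<^bsub>mpoly_ring R I\<^esub> f)"
  shows "Q f"
proof -
  have "f \<in> indexed_pset I (carrier R)" using assms(1) by (simp add: mpoly_ring_simps)
  then show ?thesis
  proof induction
    case (indexed_pmult f i)
    then show ?case
      using assms(4)[of f i] indexed_pmult_eq_var_mult[of f I i] by (simp add: mpoly_ring_simps)
  qed (use assms(2,3) in \<open>simp_all add: mpoly_ring_simps\<close>)
qed

end


subsection \<open>Partial derivatives\<close>

text \<open>The formal partial derivative: the monomial m of the derivative can only come from m
  times the i-th variable, where that variable has exponent \<open>Suc (count m i)\<close>.\<close>

definition mpoly_pderiv ::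
    "('a, 'm) ring_scheme \<Rightarrow> 'i \<Rightarrow> ('i multiset \<Rightarrow> 'a) \<Rightarrow> 'i multiset \<Rightarrow> 'a" where
  "mpoly_pderiv A i f = (\<lambda>m. [Suc (count m i)] \<cdot>\<^bsub>A\<^esub> f (add_mset i m))"

context cring
begin

lemma mpoly_pderiv_const: "a \<in> carrier R \<Longrightarrow> mpoly_pderiv R i (indexed_const a) = indexed_const \<zero>"
  by (auto simp: mpoly_pderiv_def indexed_const_def)

lemma mpoly_pderiv_add:
  assumes "carrier_coeff f" "carrier_coeff g"
  shows "mpoly_pderiv R i (indexed_padd f g)
    = indexed_padd (mpoly_pderiv R i f) (mpoly_pderiv R i g)"
  using assms by (auto simp: mpoly_pderiv_def indexed_padd_def carrier_coeff_def add.nat_pow_distrib a_ac)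

text \<open>For i = j and j in m, the factor \<open>count m j + 1\<close> splits into
  \<open>count m j\<close>, which belongs to the shifted derivative, and 1, which gives the extra
  summand f. If j is not in m the shifted derivative contributes nothing and the factor is just
  1.\<close>

lemma mpoly_pderiv_pmult:
  assumes "carrier_coeff f"
  shows "mpoly_pderiv R i (indexed_pmult f j)
    = indexed_padd (indexed_pmult (mpoly_pderiv R i f) j) (if i = j then f else indexed_const \<zero>)"
proof
  fix m
  note [simp] = assms[THEN carrier_coeffE]
  show "mpoly_pderiv R i (indexed_pmult f j) m
      = indexed_padd (indexed_pmult (mpoly_pderiv R i f) j) (if i = j then f else indexed_const \<zero>) m"
  proof (cases "j \<in># m")
    case True
    then obtain n where "m = add_mset j n" by (metis insert_DiffM)
    then show ?thesis
      by (auto simp: mpoly_pderiv_def indexed_pmult_def indexed_padd_def indexed_const_def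
          add.nat_pow_Suc)
  next
    case False
    then have "count m j = 0" by (simp add: not_in_iff)
    with False show ?thesis
      by (auto simp: mpoly_pderiv_def indexed_pmult_def indexed_padd_def indexed_const_def)
  qed
qed

lemma mpoly_pderiv_closed:
  assumes "f \<in> carrier (mpoly_ring R I)"
  shows "mpoly_pderiv R i f \<in> carrier (mpoly_ring R I)"
proof -
  have "f \<in> indexed_pset I (carrier R)" using assms by (simp add: mpoly_ring_simps)
  then have "mpoly_pderiv R i f \<in> indexed_pset I (carrier R)"
    by induction (auto simp: mpoly_pderiv_const mpoly_pderiv_add mpoly_pderiv_pmult
        indexed_pset_coeff intro!: indexed_pset.intros)
  then show ?thesis by (simp add: mpoly_ring_simps)
qed

lemma mpoly_pderiv_ring_add:
  assumes "f \<in> carrier (mpoly_ring R I)" "g \<in> carrier (mpoly_ring R I)"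
  shows "mpoly_pderiv R i (f \<oplus>\<^bsub>mpoly_ring R I\<^esub> g)
    = mpoly_pderiv R i f \<oplus>\<^bsub>mpoly_ring R I\<^esub> mpoly_pderiv R i g"
  using assms by (simp add: mpoly_ring_simps mpoly_pderiv_add indexed_pset_coeff)

lemma mpoly_pderiv_var_mult:
  assumes f: "f \<in> carrier (mpoly_ring R I)"
  shows "mpoly_pderiv R i (indexed_var j \<otimes>\<^bsub>mpoly_ring R I\<^esub> f)
    = (indexed_var j \<otimes>\<^bsub>mpoly_ring R I\<^esub> mpoly_pderiv R i f)
      \<oplus>\<^bsub>mpoly_ring R I\<^esub> (if i = j then f else \<zero>\<^bsub>mpoly_ring R I\<^esub>)"
  using mpoly_pderiv_pmult[of f i j] f mpoly_pderiv_closed[OF f]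
  by (simp add: indexed_pmult_eq_var_mult[symmetric] indexed_pset_coeff mpoly_ring_simps(1,4,5))

lemma mpoly_pderiv_var:
  assumes "j \<in> I"
  shows "mpoly_pderiv R i (indexed_var j)
    = (if i = j then \<one>\<^bsub>mpoly_ring R I\<^esub> else \<zero>\<^bsub>mpoly_ring R I\<^esub>)"
  using mpoly_pderiv_pmult[of "indexed_const \<one>" i j]
  by (simp add: mpoly_ring_simps indexed_var_def carrier_coeff_const mpoly_pderiv_const
      indexed_padd_const)

text \<open>Induction on f alone. Regrouping (x_j f) g as x_j (f g) reduces the last case to the
  rule for a product with a single variable.\<close>

lemma mpoly_pderiv_mult:
  assumes f: "f \<in> carrier (mpoly_ring R I)" and g: "g \<in> carrier (mpoly_ring R I)"
  shows "mpoly_pderiv R i (f \<otimes>\<^bsub>mpoly_ring R I\<^esub> g)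
    = (f \<otimes>\<^bsub>mpoly_ring R I\<^esub> mpoly_pderiv R i g)
      \<oplus>\<^bsub>mpoly_ring R I\<^esub> (g \<otimes>\<^bsub>mpoly_ring R I\<^esub> mpoly_pderiv R i f)"
  using f
proof (induction rule: mpoly_ring_induct)
  case (const a)
  interpret P: cring "mpoly_ring R I" by (rule cring_mpoly_ring)
  have gc: "carrier_coeff g" "carrier_coeff (mpoly_pderiv R i g)"
    using g mpoly_pderiv_closed[OF g, of i] by (simp_all add: mpoly_ring_simps indexed_pset_coeff)
  have "mpoly_pderiv R i (\<lambda>m. a \<otimes> g m) = (\<lambda>m. a \<otimes> mpoly_pderiv R i g m)"
    using gc const by (simp add: mpoly_pderiv_def carrier_coeff_def add_pow_rdistr r_distr)
  then have "mpoly_pderiv R i (indexed_const a \<otimes>\<^bsub>mpoly_ring R I\<^esub> g)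
      = indexed_const a \<otimes>\<^bsub>mpoly_ring R I\<^esub> mpoly_pderiv R i g"
    using gc const by (simp add: mpoly_ring_simps(2) mpoly_mult_const)
  moreover have "mpoly_pderiv R i (indexed_const a) = \<zero>\<^bsub>mpoly_ring R I\<^esub>"
    using const by (simp add: mpoly_pderiv_const mpoly_ring_simps)
  ultimately show ?case
    using g const by (simp add: mpoly_pderiv_closed indexed_const_closed)
next
  case (add f h)
  interpret P: cring "mpoly_ring R I" by (rule cring_mpoly_ring)
  note [simp] = mpoly_pderiv_closed[where I = I]
  show ?case
    using add g by (simp add: P.l_distr P.r_distr mpoly_pderiv_ring_add P.a_ac)
next
  case (var_mult f j)
  interpret P: cring "mpoly_ring R I" by (rule cring_mpoly_ring)
  note [simp] = mpoly_pderiv_closed[where I = I]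
  note [simp] = var_mult.hyps(1) g indexed_var_closed[OF var_mult.hyps(2)]
  have "mpoly_pderiv R i ((indexed_var j \<otimes>\<^bsub>mpoly_ring R I\<^esub> f) \<otimes>\<^bsub>mpoly_ring R I\<^esub> g)
      = mpoly_pderiv R i (indexed_var j \<otimes>\<^bsub>mpoly_ring R I\<^esub> (f \<otimes>\<^bsub>mpoly_ring R I\<^esub> g))"
    by (simp add: P.m_assoc)
  also have "\<dots> = indexed_var j \<otimes>\<^bsub>mpoly_ring R I\<^esub> ((f \<otimes>\<^bsub>mpoly_ring R I\<^esub> mpoly_pderiv R i g)
        \<oplus>\<^bsub>mpoly_ring R I\<^esub> (g \<otimes>\<^bsub>mpoly_ring R I\<^esub> mpoly_pderiv R i f))
      \<oplus>\<^bsub>mpoly_ring R I\<^esub> (if i = j then f \<otimes>\<^bsub>mpoly_ring R I\<^esub> g else \<zero>\<^bsub>mpoly_ring R I\<^esub>)"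
    by (subst mpoly_pderiv_var_mult) (auto simp: var_mult.IH)
  also have "\<dots> = ((indexed_var j \<otimes>\<^bsub>mpoly_ring R I\<^esub> f) \<otimes>\<^bsub>mpoly_ring R I\<^esub> mpoly_pderiv R i g)
      \<oplus>\<^bsub>mpoly_ring R I\<^esub> (g \<otimes>\<^bsub>mpoly_ring R I\<^esub> ((indexed_var j \<otimes>\<^bsub>mpoly_ring R I\<^esub> mpoly_pderiv R i f)
        \<oplus>\<^bsub>mpoly_ring R I\<^esub> (if i = j then f else \<zero>\<^bsub>mpoly_ring R I\<^esub>)))"
    by (auto simp: P.r_distr P.a_ac P.m_ac)
  finally show ?case by (simp add: mpoly_pderiv_var_mult)
qed

end


section \<open>Modules\<close>

lemma (in abelian_group) minus_eq_zero_iff: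
  assumes "x \<in> carrier G" "y \<in> carrier G"
  shows "x \<ominus> y = \<zero> \<longleftrightarrow> x = y"
  using assms add.inv_equality[of x "\<ominus> y"] by (auto simp: a_minus_def r_neg)


lemma (in module) finsum_smult_rdistr:
  assumes "f \<in> I \<rightarrow> carrier R" "u \<in> carrier M"
  shows "(\<Oplus>i\<in>I. f i) \<odot>\<^bsub>M\<^esub> u = (\<Oplus>\<^bsub>M\<^esub>i\<in>I. f i \<odot>\<^bsub>M\<^esub> u)"
  using assms
  by (induct I rule: infinite_finite_induct) (auto simp: smult_l_distr Pi_def)


subsection \<open>Linear maps\<close>

text \<open>Linearity without the extensionality that \<open>module_homs\<close> demands, so that
  projections, compositions and the identity are instances. \<open>module_homs_iff\<close> and
  \<open>module_hom_restrict\<close> pass between the two notions.\<close>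

locale module_hom = M: module R M + N: module R N
  for R (structure) and M and N and h +
  assumes hom_closed: "u \<in> carrier M \<Longrightarrow> h u \<in> carrier N"
    and hom_add: "\<lbrakk>u \<in> carrier M; v \<in> carrier M\<rbrakk> \<Longrightarrow> h (u \<oplus>\<^bsub>M\<^esub> v) = h u \<oplus>\<^bsub>N\<^esub> h v"
    and hom_smult: "\<lbrakk>c \<in> carrier R; u \<in> carrier M\<rbrakk> \<Longrightarrow> h (c \<odot>\<^bsub>M\<^esub> u) = c \<odot>\<^bsub>N\<^esub> h u"
begin

lemma hom_zero: "h \<zero>\<^bsub>M\<^esub> = \<zero>\<^bsub>N\<^esub>"
  using hom_smult[of \<zero> "\<zero>\<^bsub>M\<^esub>"] by (simp add: hom_closed)

lemma hom_neg:
  assumes "u \<in> carrier M"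
  shows "h (\<ominus>\<^bsub>M\<^esub> u) = \<ominus>\<^bsub>N\<^esub> h u"
proof -
  have "h (\<ominus>\<^bsub>M\<^esub> u) \<oplus>\<^bsub>N\<^esub> h u = \<zero>\<^bsub>N\<^esub>"
    using assms by (simp add: hom_add[symmetric] hom_zero M.M.l_neg)
  then show ?thesis
    using assms by (simp add: N.M.minus_equality hom_closed)
qed

lemma hom_minus:
  "\<lbrakk>u \<in> carrier M; v \<in> carrier M\<rbrakk> \<Longrightarrow> h (u \<ominus>\<^bsub>M\<^esub> v) = h u \<ominus>\<^bsub>N\<^esub> h v"
  by (simp add: a_minus_def hom_add hom_neg)

lemma hom_finsum:
  assumes "f \<in> I \<rightarrow> carrier M"
  shows "h (\<Oplus>\<^bsub>M\<^esub>i\<in>I. f i) = (\<Oplus>\<^bsub>N\<^esub>i\<in>I. h (f i))"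
  using assms
  by (induct I rule: infinite_finite_induct) (auto simp: hom_zero hom_add hom_closed Pi_def)

text \<open>With \<open>span_minimal\<close> this reduces vanishing on a generated submodule of
  relations to vanishing on its generators.\<close>

lemma submodule_kernel: "submodule {u \<in> carrier M. h u = \<zero>\<^bsub>N\<^esub>} R M"
  by (rule M.submoduleI) (auto simp: hom_zero hom_add hom_neg hom_smult)

end

lemma module_homs_iff:
  assumes "module R M" "module R N"
  shows "h \<in> module_homs R M N \<longleftrightarrow> module_hom R M N h \<and> h \<in> extensional (carrier M)"
  using assms
  by (auto simp: module_homs_def module_hom_def module_hom_axioms_def PiE_def Pi_def)

lemma module_hom_restrict:
  assumes "module_hom R M N h"
  shows "restrict h (carrier M) \<in> module_homs R M N"
proof -
  interpret module_hom R M N h by fact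
  show ?thesis
    by (auto simp: module_homs_def hom_closed hom_add hom_smult)
qed


subsection \<open>Generated submodules\<close>

lemma (in module) submodule_Inter:
  assumes "\<N> \<noteq> {}" "\<And>N. N \<in> \<N> \<Longrightarrow> submodule N R M"
  shows "submodule (\<Inter>\<N>) R M"
proof (rule submoduleI)
  show "\<Inter>\<N> \<subseteq> carrier M" using assms(1) submoduleE(1)[OF assms(2)] by blast
  show "\<zero>\<^bsub>M\<^esub> \<in> \<Inter>\<N>"
    using subgroup.one_closed[OF submodule.axioms(1)[OF assms(2)]] by simp
  show "\<ominus>\<^bsub>M\<^esub> a \<in> \<Inter>\<N>" if "a \<in> \<Inter>\<N>" for a
    using that submoduleE(3)[OF assms(2)] by blast
  show "a \<oplus>\<^bsub>M\<^esub> b \<in> \<Inter>\<N>" if "a \<in> \<Inter>\<N>" "b \<in> \<Inter>\<N>" for a b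
    using that submoduleE(5)[OF assms(2)] by blast
  show "c \<odot>\<^bsub>M\<^esub> a \<in> \<Inter>\<N>" if "c \<in> carrier R" "a \<in> \<Inter>\<N>" for c a
    using that submoduleE(4)[OF assms(2)] by blast
qed

text \<open>Since B lies in the carrier, the carrier itself is one of the submodules intersected.
  The family is therefore nonempty and its intersection stays inside the module.\<close>

lemma (in module) submodule_span:
  assumes "B \<subseteq> carrier M"
  shows "submodule (submodule_span R M B) R M"
  unfolding submodule_span_def
  by (rule submodule_Inter) (use assms carrier_is_submodule in auto)

lemma span_superset: "B \<subseteq> submodule_span R M B"
  by (auto simp: submodule_span_def)

lemma span_minimal: "\<lbrakk>submodule H R M; B \<subseteq> H\<rbrakk> \<Longrightarrow> submodule_span R M B \<subseteq> H"
  by (auto simp: submodule_span_def)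


subsection \<open>Quotient modules\<close>

locale quotient_module = module R M for R and M (structure) +
  fixes N
  assumes sub: "submodule N R M"
begin

sublocale abelian_subgroup N M
  by (rule abelian_subgroupI3)
    (use sub in \<open>auto simp: additive_subgroup_def submodule_def intro: M.abelian_group_axioms\<close>)

lemma quot_simps:
  "carrier (quot_module M N) = a_rcosets N"
  "\<zero>\<^bsub>quot_module M N\<^esub> = N"
  "U \<oplus>\<^bsub>quot_module M N\<^esub> V = U <+> V"
  "c \<odot>\<^bsub>quot_module M N\<^esub> U = (\<Union>u\<in>U. N +> (c \<odot> u))"
  by (simp_all add: quot_module_def)

lemma quot_carrier_iff: "U \<in> carrier (quot_module M N) \<longleftrightarrow> (\<exists>u\<in>carrier M. U = N +> u)"
  by (auto simp: quot_simps A_RCOSETS_def' a_r_coset_def' image_iff)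

lemma quot_add:
  "\<lbrakk>u \<in> carrier M; v \<in> carrier M\<rbrakk> \<Longrightarrow> (N +> u) \<oplus>\<^bsub>quot_module M N\<^esub> (N +> v) = N +> (u \<oplus> v)"
  by (simp add: quot_simps a_rcos_sum)

lemma quot_eq_iff:
  assumes "u \<in> carrier M" "v \<in> carrier M"
  shows "N +> u = N +> v \<longleftrightarrow> u \<ominus> v \<in> N"
proof
  assume "N +> u = N +> v"
  then have "u \<in> N +> v" using a_rcos_self[OF assms(1)] by simp
  then show "u \<ominus> v \<in> N" using assms by (simp add: a_rcos_module a_minus_def)
next
  assume "u \<ominus> v \<in> N"
  then have "u \<in> N +> v" using assms by (simp add: a_rcos_module a_minus_def)
  then show "N +> u = N +> v" using assms by (metis a_repr_independence')
qed

text \<open>Scalar multiplication on the quotient is a union over all representatives. Members of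
  one coset differ by an element of N, and N is stable under scalars, so all the united cosets
  coincide.\<close>

lemma quot_smult:
  assumes c: "c \<in> carrier R" and u: "u \<in> carrier M"
  shows "c \<odot>\<^bsub>quot_module M N\<^esub> (N +> u) = N +> (c \<odot> u)"
proof -
  have "N +> (c \<odot> v) = N +> (c \<odot> u)" if v: "v \<in> N +> u" for v
  proof -
    have vM: "v \<in> carrier M" by (rule a_elemrcos_carrier[OF u v])
    have "v \<ominus> u \<in> N" using v u vM by (simp add: a_rcos_module a_minus_def)
    then have "c \<odot> (v \<ominus> u) \<in> N" using submoduleE(4)[OF sub] c by blast
    moreover have "c \<odot> (v \<ominus> u) = c \<odot> v \<ominus> c \<odot> u"
      using c u vM by (simp add: a_minus_def smult_r_distr smult_r_minus)
    ultimately show ?thesis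
      using c u vM by (simp add: quot_eq_iff)
  qed
  moreover have "u \<in> N +> u" by (rule a_rcos_self[OF u])
  ultimately show ?thesis unfolding quot_simps by blast
qed

lemma module_quot: "module R (quot_module M N)"
proof (rule moduleI)
  have "N +> \<zero>\<^bsub>M\<^esub> = N" by (rule a_coset_add_zero[OF a_subset])
  \<comment> \<open>With the zero also written as a coset, every element has the form N +> u and the
    group axioms reduce to those of M.\<close>
  then have zero: "\<zero>\<^bsub>quot_module M N\<^esub> = N +> \<zero>\<^bsub>M\<^esub>" by (simp only: quot_simps)
  show "abelian_group (quot_module M N)"
  proof (rule abelian_groupI, unfold zero quot_carrier_iff)
    fix U assume "\<exists>u\<in>carrier M. U = N +> u"
    then obtain u where u: "u \<in> carrier M" "U = N +> u" by blast
    then have "(N +> (\<ominus> u)) \<oplus>\<^bsub>quot_module M N\<^esub> U = N +> \<zero>\<^bsub>M\<^esub>"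
      by (simp add: quot_add M.l_neg)
    moreover have "N +> (\<ominus> u) \<in> carrier (quot_module M N)"
      using u(1) quot_carrier_iff M.a_inv_closed by blast
    ultimately show "\<exists>V\<in>carrier (quot_module M N). V \<oplus>\<^bsub>quot_module M N\<^esub> U = N +> \<zero>\<^bsub>M\<^esub>"
      by blast
  qed (auto simp: quot_add M.a_assoc intro: M.a_closed, auto simp: M.a_comm)
qed (auto simp: quot_carrier_iff quot_add quot_smult smult_l_distr smult_r_distr smult_assoc1
      R.is_cring)

lemma module_hom_quot: "module_hom R M (quot_module M N) (\<lambda>u. N +> u)"
  unfolding module_hom_def module_hom_axioms_def
  using module_axioms module_quot by (auto simp: quot_carrier_iff quot_add quot_smult)

text \<open>The value on a coset is read off at a chosen representative; two representatives differ
  by an element of N, where h vanishes. The final restriction to the carrier supplies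
  extensionality.\<close>

lemma quot_factor:
  assumes h: "module_hom R M L h" and ker: "\<And>n. n \<in> N \<Longrightarrow> h n = \<zero>\<^bsub>L\<^esub>"
  obtains h' where "h' \<in> module_homs R (quot_module M N) L"
    and "\<And>u. u \<in> carrier M \<Longrightarrow> h' (N +> u) = h u"
proof -
  interpret h: module_hom R M L h by (rule h)
  define h' where "h' = (\<lambda>U. h (SOME u. u \<in> carrier M \<and> U = N +> u))"
  have val: "h' (N +> u) = h u" if u: "u \<in> carrier M" for u
  proof -
    define v where "v = (SOME v. v \<in> carrier M \<and> N +> u = N +> v)"
    have v: "v \<in> carrier M" "N +> u = N +> v"
      using someI[of "\<lambda>v. v \<in> carrier M \<and> N +> u = N +> v" u] u by (auto simp: v_def)
    then have "h (u \<ominus> v) = \<zero>\<^bsub>L\<^esub>" using u quot_eq_iff ker by blast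
    then have "h u = h v"
      using u v by (simp add: h.hom_minus h.hom_closed h.N.minus_eq_zero_iff)
    then show ?thesis by (simp add: h'_def v_def)
  qed
  have "module_hom R (quot_module M N) L h'"
    unfolding module_hom_def module_hom_axioms_def
    using module_quot h.N.module_axioms
    by (auto simp: quot_carrier_iff quot_add quot_smult val h.hom_closed h.hom_add h.hom_smult)
  then show ?thesis
    by (intro that[of "restrict h' (carrier (quot_module M N))"] module_hom_restrict)
      (auto simp: val quot_carrier_iff)
qed

end


subsection \<open>Free modules\<close>

context cring
begin

lemma free_module_simps:
  "carrier (free_module R S) = {f. (\<forall>t\<in>S. f t \<in> carrier R) \<and> (\<forall>t. t \<notin> S \<longrightarrow> f t = \<zero>)
     \<and> finite {t. f t \<noteq> \<zero>}}"
  "\<zero>\<^bsub>free_module R S\<^esub> = (\<lambda>t. \<zero>)"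
  "f \<oplus>\<^bsub>free_module R S\<^esub> g = (\<lambda>t. f t \<oplus> g t)"
  "c \<odot>\<^bsub>free_module R S\<^esub> f = (\<lambda>t. c \<otimes> f t)"
  by (simp_all add: free_module_def)

lemma free_module_apply_closed: "f \<in> carrier (free_module R S) \<Longrightarrow> f t \<in> carrier R"
  by (cases "t \<in> S") (auto simp: free_module_simps)

lemma free_module_smult_closed:
  assumes "c \<in> carrier R" "f \<in> carrier (free_module R S)"
  shows "c \<odot>\<^bsub>free_module R S\<^esub> f \<in> carrier (free_module R S)"
proof -
  have "finite {t. c \<otimes> f t \<noteq> \<zero>}"
    by (rule finite_subset[of _ "{t. f t \<noteq> \<zero>}"]) (use assms in \<open>auto simp: free_module_simps\<close>)
  then show ?thesis using assms by (simp add: free_module_simps)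
qed

lemma module_free_module: "module R (free_module R S)"
proof (rule moduleI)
  show "abelian_group (free_module R S)"
  proof (rule abelian_groupI)
    fix f g assume f: "f \<in> carrier (free_module R S)" and g: "g \<in> carrier (free_module R S)"
    have "finite {t. f t \<oplus> g t \<noteq> \<zero>}"
      by (rule finite_subset[of _ "{t. f t \<noteq> \<zero>} \<union> {t. g t \<noteq> \<zero>}"])
        (use f g in \<open>auto simp: free_module_simps\<close>)
    then show "f \<oplus>\<^bsub>free_module R S\<^esub> g \<in> carrier (free_module R S)"
      using f g by (simp add: free_module_simps)
  next
    fix f assume f: "f \<in> carrier (free_module R S)"
    \<comment> \<open>The negative is taken as (-1) f, so that its finite support is an instance of
      closure under scalars.\<close>
    have "(\<lambda>t. \<ominus> \<one> \<otimes> f t) \<in> carrier (free_module R S)"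
      using free_module_smult_closed[of "\<ominus> \<one>" f S] f by (simp add: free_module_simps(4))
    moreover have "(\<lambda>t. \<ominus> \<one> \<otimes> f t) \<oplus>\<^bsub>free_module R S\<^esub> f = \<zero>\<^bsub>free_module R S\<^esub>"
      using free_module_apply_closed[OF f] by (simp add: free_module_simps(2,3) l_minus l_neg)
    ultimately show "\<exists>g\<in>carrier (free_module R S). g \<oplus>\<^bsub>free_module R S\<^esub> f = \<zero>\<^bsub>free_module R S\<^esub>"
      by blast
  qed (auto simp: free_module_simps(2,3) free_module_apply_closed a_ac,
      simp_all add: free_module_simps(1))
qed (auto simp: free_module_smult_closed is_cring,
    auto simp: free_module_simps(3,4) free_module_apply_closed l_distr r_distr m_assoc)

lemma free_basis_closed: "t \<in> S \<Longrightarrow> free_basis R t \<in> carrier (free_module R S)"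
  by (auto simp: free_module_simps free_basis_def intro: finite_subset[of _ "{t}"])

text \<open>Induction on the finite support: setting one nonzero coefficient to zero shrinks it, and
  the removed part is a multiple of a basis element.\<close>

lemma free_module_induct [consumes 1, case_names zero add]:
  assumes "f \<in> carrier (free_module R S)"
    and "Q \<zero>\<^bsub>free_module R S\<^esub>"
    and "\<And>c t f. \<lbrakk>c \<in> carrier R; t \<in> S; f \<in> carrier (free_module R S); Q f\<rbrakk>
      \<Longrightarrow> Q (c \<odot>\<^bsub>free_module R S\<^esub> free_basis R t \<oplus>\<^bsub>free_module R S\<^esub> f)"
  shows "Q f"
proof -
  have "finite {t. f t \<noteq> \<zero>}" using assms(1) by (simp add: free_module_simps)
  then show ?thesis using assms(1)
  proof (induction "{t. f t \<noteq> \<zero>}" arbitrary: f rule: finite_psubset_induct)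
    case psubset
    show ?case
    proof (cases "{t. f t \<noteq> \<zero>} = {}")
      case True
      then have "f = \<zero>\<^bsub>free_module R S\<^esub>" by (auto simp: free_module_simps)
      then show ?thesis using assms(2) by simp
    next
      case False
      then obtain t where t: "f t \<noteq> \<zero>" by auto
      define g where "g = f(t := \<zero>)"
      have sub: "{u. g u \<noteq> \<zero>} \<subset> {u. f u \<noteq> \<zero>}" using t by (auto simp: g_def)
      have tS: "t \<in> S" using psubset.prems t by (auto simp: free_module_simps)
      have g: "g \<in> carrier (free_module R S)"
        using psubset.prems sub
        by (auto simp: free_module_simps g_def intro: finite_subset[of _ "{u. f u \<noteq> \<zero>}"])
      have "f = f t \<odot>\<^bsub>free_module R S\<^esub> free_basis R t \<oplus>\<^bsub>free_module R S\<^esub> g"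
        using free_module_apply_closed[OF psubset.prems]
        by (auto simp: free_module_simps free_basis_def g_def)
      then show ?thesis
        using assms(3)[of "f t" t g] psubset.hyps(2)[OF sub g] tS g
          free_module_apply_closed[OF psubset.prems] by simp
    qed
  qed
qed

lemma free_module_lift:
  assumes "module R M" and g: "\<And>t. t \<in> S \<Longrightarrow> g t \<in> carrier M"
  obtains h where "module_hom R (free_module R S) M h"
    and "\<And>t. t \<in> S \<Longrightarrow> h (free_basis R t) = g t"
proof -
  interpret M: module R M by fact
  define h where "h = (\<lambda>f. \<Oplus>\<^bsub>M\<^esub>t\<in>{t. f t \<noteq> \<zero>}. f t \<odot>\<^bsub>M\<^esub> g t)"
  have supp: "t \<in> S" if "f \<in> carrier (free_module R S)" "f t \<noteq> \<zero>" for f t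
    using that by (auto simp: free_module_simps)
  \<comment> \<open>The support varies with f. This equation replaces it by any larger finite set of
    basis indices, so that two elements and their sum can be compared over one index set.\<close>
  have h_eq: "h f = (\<Oplus>\<^bsub>M\<^esub>t\<in>B. f t \<odot>\<^bsub>M\<^esub> g t)"
    if "f \<in> carrier (free_module R S)" "finite B" "{t. f t \<noteq> \<zero>} \<subseteq> B" "B \<subseteq> S" for f B
    unfolding h_def using that free_module_apply_closed[OF that(1)] g
    by (intro M.M.add.finprod_mono_neutral_cong_left) auto
  have fin: "finite {t. f t \<noteq> \<zero>}" if "f \<in> carrier (free_module R S)" for f
    using that by (simp add: free_module_simps)
  interpret F: module R "free_module R S" by (rule module_free_module)
  have "module_hom R (free_module R S) M h"
  proof
    fix f assume f: "f \<in> carrier (free_module R S)"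
    show "h f \<in> carrier M"
      unfolding h_def using supp[OF f] free_module_apply_closed[OF f] g
      by (intro M.M.finsum_closed) auto
    fix f' assume f': "f' \<in> carrier (free_module R S)"
    let ?B = "{t. f t \<noteq> \<zero>} \<union> {t. f' t \<noteq> \<zero>}"
    have B: "finite ?B" "?B \<subseteq> S" using fin f f' supp by auto
    have "{t. (f \<oplus>\<^bsub>free_module R S\<^esub> f') t \<noteq> \<zero>} \<subseteq> ?B"
      by (auto simp: free_module_simps(3))
    from h_eq[OF F.M.a_closed[OF f f'] B(1) this B(2)]
    have "h (f \<oplus>\<^bsub>free_module R S\<^esub> f') = (\<Oplus>\<^bsub>M\<^esub>t\<in>?B. (f t \<oplus> f' t) \<odot>\<^bsub>M\<^esub> g t)"
      by (simp add: free_module_simps(3))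
    also have "\<dots> = (\<Oplus>\<^bsub>M\<^esub>t\<in>?B. f t \<odot>\<^bsub>M\<^esub> g t \<oplus>\<^bsub>M\<^esub> f' t \<odot>\<^bsub>M\<^esub> g t)"
      using B(2) g free_module_apply_closed[OF f] free_module_apply_closed[OF f']
      by (intro M.M.add.finprod_cong') (auto simp: M.smult_l_distr)
    also have "\<dots> = (\<Oplus>\<^bsub>M\<^esub>t\<in>?B. f t \<odot>\<^bsub>M\<^esub> g t) \<oplus>\<^bsub>M\<^esub> (\<Oplus>\<^bsub>M\<^esub>t\<in>?B. f' t \<odot>\<^bsub>M\<^esub> g t)"
      using B(2) g free_module_apply_closed[OF f] free_module_apply_closed[OF f']
      by (intro M.M.finsum_addf) auto
    also have "\<dots> = h f \<oplus>\<^bsub>M\<^esub> h f'"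
      using h_eq[OF f B(1) _ B(2)] h_eq[OF f' B(1) _ B(2)] by simp
    finally show "h (f \<oplus>\<^bsub>free_module R S\<^esub> f') = h f \<oplus>\<^bsub>M\<^esub> h f'" .
  next
    fix c f assume c: "c \<in> carrier R" and f: "f \<in> carrier (free_module R S)"
    let ?B = "{t. f t \<noteq> \<zero>}"
    have B: "finite ?B" "?B \<subseteq> S" using fin f supp by auto
    have "{t. (c \<odot>\<^bsub>free_module R S\<^esub> f) t \<noteq> \<zero>} \<subseteq> ?B"
      using c by (auto simp: free_module_simps(4))
    from h_eq[OF F.smult_closed[OF c f] B(1) this B(2)]
    have "h (c \<odot>\<^bsub>free_module R S\<^esub> f) = (\<Oplus>\<^bsub>M\<^esub>t\<in>?B. (c \<otimes> f t) \<odot>\<^bsub>M\<^esub> g t)"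
      by (simp add: free_module_simps(4))
    also have "\<dots> = (\<Oplus>\<^bsub>M\<^esub>t\<in>?B. c \<odot>\<^bsub>M\<^esub> (f t \<odot>\<^bsub>M\<^esub> g t))"
      using B(2) g free_module_apply_closed[OF f] c
      by (intro M.M.add.finprod_cong') (auto simp: M.smult_assoc1)
    also have "\<dots> = c \<odot>\<^bsub>M\<^esub> h f"
      unfolding h_def using B g free_module_apply_closed[OF f] c
      by (intro M.finsum_smult_ldistr[symmetric]) auto
    finally show "h (c \<odot>\<^bsub>free_module R S\<^esub> f) = c \<odot>\<^bsub>M\<^esub> h f" .
  qed
  moreover have "h (free_basis R t) = g t" if t: "t \<in> S" for t
  proof -
    have "h (free_basis R t) = (\<Oplus>\<^bsub>M\<^esub>u\<in>{t}. free_basis R t u \<odot>\<^bsub>M\<^esub> g u)"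
      using t by (intro h_eq free_basis_closed) (auto simp: free_basis_def)
    then show ?thesis using t g by (simp add: free_basis_def)
  qed
  ultimately show thesis using that by blast
qed

end


section \<open>Kaehler differentials\<close>

locale kaehler_differentials = cring C for C (structure) +
  fixes A :: "('k, 'l) ring_scheme" and \<phi>
  assumes scalar_closed: "a \<in> carrier A \<Longrightarrow> \<phi> a \<in> carrier C"
begin

abbreviation "L \<equiv> kaehler_free C"
abbreviation "\<Omega> \<equiv> kaehler A C \<phi>"
abbreviation "d \<equiv> kaehler_d A C \<phi>"

lemma module_L: "module C L"
  by (simp add: kaehler_free_def module_free_module)

sublocale L: module C L by (rule module_L)

lemma basis_closed: "c \<in> carrier C \<Longrightarrow> free_basis C c \<in> carrier L"
  by (simp add: kaehler_free_def free_basis_closed)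

lemma submodule_relations: "submodule (kaehler_relations A C \<phi>) C L"
  unfolding kaehler_relations_def Let_def
  by (rule L.submodule_span)
    (auto intro!: L.M.minus_closed L.M.a_closed L.smult_closed basis_closed scalar_closed)

lemma relations:
  "\<lbrakk>b \<in> carrier C; c \<in> carrier C\<rbrakk> \<Longrightarrow>
    free_basis C (b \<oplus> c) \<ominus>\<^bsub>L\<^esub> (free_basis C b \<oplus>\<^bsub>L\<^esub> free_basis C c) \<in> kaehler_relations A C \<phi>"
  "\<lbrakk>b \<in> carrier C; c \<in> carrier C\<rbrakk> \<Longrightarrow>
    free_basis C (b \<otimes> c) \<ominus>\<^bsub>L\<^esub> (b \<odot>\<^bsub>L\<^esub> free_basis C c \<oplus>\<^bsub>L\<^esub> c \<odot>\<^bsub>L\<^esub> free_basis C b)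
      \<in> kaehler_relations A C \<phi>"
  "a \<in> carrier A \<Longrightarrow> free_basis C (\<phi> a) \<in> kaehler_relations A C \<phi>"
  unfolding kaehler_relations_def Let_def by (rule subsetD[OF span_superset], blast)+

sublocale Q: quotient_module C L "kaehler_relations A C \<phi>"
  by (simp add: quotient_module_def quotient_module_axioms_def module_L submodule_relations)

lemma module_kaehler: "module C \<Omega>"
  using Q.module_quot by (simp add: kaehler_def)

sublocale \<Omega>: module C \<Omega> by (rule module_kaehler)

lemma proj_hom: "module_hom C L \<Omega> (\<lambda>u. kaehler_relations A C \<phi> +>\<^bsub>L\<^esub> u)"
  using Q.module_hom_quot by (simp add: kaehler_def)

sublocale proj: module_hom C L \<Omega> "\<lambda>u. kaehler_relations A C \<phi> +>\<^bsub>L\<^esub> u"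
  by (rule proj_hom)

lemma d_closed: "c \<in> carrier C \<Longrightarrow> d c \<in> carrier \<Omega>"
  by (simp add: kaehler_d_def proj.hom_closed basis_closed)

lemma d_add:
  assumes "b \<in> carrier C" "c \<in> carrier C"
  shows "d (b \<oplus> c) = d b \<oplus>\<^bsub>\<Omega>\<^esub> d c"
  using assms relations(1)[OF assms]
  by (simp add: kaehler_d_def proj.hom_add[symmetric] Q.quot_eq_iff basis_closed)

lemma d_mult:
  assumes "b \<in> carrier C" "c \<in> carrier C"
  shows "d (b \<otimes> c) = b \<odot>\<^bsub>\<Omega>\<^esub> d c \<oplus>\<^bsub>\<Omega>\<^esub> c \<odot>\<^bsub>\<Omega>\<^esub> d b"
  using assms relations(2)[OF assms]
  by (simp add: kaehler_d_def proj.hom_add[symmetric] proj.hom_smult[symmetric] Q.quot_eq_iff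
      basis_closed)

lemma d_scalar:
  assumes "a \<in> carrier A"
  shows "d (\<phi> a) = \<zero>\<^bsub>\<Omega>\<^esub>"
proof -
  \<comment> \<open>Equality of cosets is tested on differences, hence the relation is written as a
    difference with zero.\<close>
  have "free_basis C (\<phi> a) \<ominus>\<^bsub>L\<^esub> \<zero>\<^bsub>L\<^esub> \<in> kaehler_relations A C \<phi>"
    using assms relations(3) by (simp add: a_minus_def basis_closed scalar_closed)
  then show ?thesis
    using assms
    by (simp add: kaehler_d_def proj.hom_zero[symmetric] Q.quot_eq_iff basis_closed scalar_closed)
qed

text \<open>The universal property of the differentials. The three conditions on D say that its
  linear extension to the free module kills the three kinds of generating relations; its kernel is a
  submodule and so contains all relations.\<close>

lemma kaehler_lift:
  assumes "module C M"
    and "\<And>c. c \<in> carrier C \<Longrightarrow> D c \<in> carrier M"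
    and "\<And>b c. \<lbrakk>b \<in> carrier C; c \<in> carrier C\<rbrakk> \<Longrightarrow> D (b \<oplus> c) = D b \<oplus>\<^bsub>M\<^esub> D c"
    and "\<And>b c. \<lbrakk>b \<in> carrier C; c \<in> carrier C\<rbrakk> \<Longrightarrow>
      D (b \<otimes> c) = b \<odot>\<^bsub>M\<^esub> D c \<oplus>\<^bsub>M\<^esub> c \<odot>\<^bsub>M\<^esub> D b"
    and "\<And>a. a \<in> carrier A \<Longrightarrow> D (\<phi> a) = \<zero>\<^bsub>M\<^esub>"
  obtains s where "s \<in> module_homs C \<Omega> M" "\<And>c. c \<in> carrier C \<Longrightarrow> s (d c) = D c"
proof -
  obtain h where h: "module_hom C L M h" "\<And>c. c \<in> carrier C \<Longrightarrow> h (free_basis C c) = D c"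
    using free_module_lift[OF assms(1), of "carrier C" D] assms(2)
    unfolding kaehler_free_def by blast
  interpret h: module_hom C L M h by (rule h)
  have "kaehler_relations A C \<phi> \<subseteq> {u \<in> carrier L. h u = \<zero>\<^bsub>M\<^esub>}"
    unfolding kaehler_relations_def Let_def
    by (rule span_minimal[OF h.submodule_kernel])
      (auto simp: h.hom_minus h.hom_add h.hom_smult h(2) basis_closed scalar_closed assms(2-5)
        h.N.minus_eq_zero_iff)
  then obtain s where "s \<in> module_homs C \<Omega> M"
      "\<And>u. u \<in> carrier L \<Longrightarrow> s (kaehler_relations A C \<phi> +>\<^bsub>L\<^esub> u) = h u"
    using Q.quot_factor[OF h(1)] unfolding kaehler_def by blast
  then show thesis
    using that[of s] by (simp add: kaehler_d_def basis_closed h(2))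
qed

text \<open>The differentials generate: an element is the class of a finite combination of symbols,
  and induction over that combination reduces equality to single symbols.\<close>

lemma kaehler_hom_eqI:
  assumes s: "module_hom C \<Omega> M s" and s': "module_hom C \<Omega> M s'"
    and eq: "\<And>c. c \<in> carrier C \<Longrightarrow> s (d c) = s' (d c)"
    and u: "u \<in> carrier \<Omega>"
  shows "s u = s' u"
proof -
  interpret s: module_hom C \<Omega> M s by (rule s)
  interpret s': module_hom C \<Omega> M s' by (rule s')
  obtain f where f: "f \<in> carrier L" "u = kaehler_relations A C \<phi> +>\<^bsub>L\<^esub> f"
    using u by (auto simp: kaehler_def Q.quot_carrier_iff)
  have "f \<in> carrier (free_module C (carrier C))" using f(1) by (simp add: kaehler_free_def)
  then have "s (kaehler_relations A C \<phi> +>\<^bsub>L\<^esub> f) = s' (kaehler_relations A C \<phi> +>\<^bsub>L\<^esub> f)"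
  proof (induction rule: free_module_induct)
    case zero
    then show ?case
      unfolding kaehler_free_def[symmetric] by (simp only: proj.hom_zero s.hom_zero s'.hom_zero)
  next
    case (add c t f)
    then have "f \<in> carrier L" "free_basis C t \<in> carrier L"
      by (simp_all add: kaehler_free_def free_basis_closed)
    then show ?case
      using add.hyps(1,2) add.IH eq[OF add.hyps(2)]
      unfolding kaehler_free_def[symmetric] kaehler_d_def
      by (simp add: proj.hom_add proj.hom_smult s.hom_add s.hom_smult s'.hom_add s'.hom_smult
          proj.hom_closed)
  qed
  then show ?thesis by (simp add: f(2))
qed

end


section \<open>Tensor products\<close>

locale tensor_product = M: module R M + N: module R N for R (structure) and M and N
begin

abbreviation "L \<equiv> tensor_free R M N"
abbreviation "T \<equiv> tensor_module R M N"
abbreviation "tensor \<equiv> pure_tensor R M N"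

lemma module_L: "module R L"
  by (simp add: tensor_free_def M.module_free_module)

sublocale L: module R L by (rule module_L)

lemma basis_closed:
  "\<lbrakk>u \<in> carrier M; v \<in> carrier N\<rbrakk> \<Longrightarrow> free_basis R (u, v) \<in> carrier L"
  by (simp add: tensor_free_def M.free_basis_closed)

lemma submodule_relations: "submodule (tensor_relations R M N) R L"
  unfolding tensor_relations_def Let_def
  by (rule L.submodule_span)
    (auto intro!: L.M.minus_closed L.M.a_closed L.smult_closed basis_closed
      M.M.a_closed N.M.a_closed M.smult_closed N.smult_closed)

lemma relations:
  "\<lbrakk>u \<in> carrier M; u' \<in> carrier M; v \<in> carrier N\<rbrakk> \<Longrightarrow>
    free_basis R (u \<oplus>\<^bsub>M\<^esub> u', v) \<ominus>\<^bsub>L\<^esub> (free_basis R (u, v) \<oplus>\<^bsub>L\<^esub> free_basis R (u', v))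
      \<in> tensor_relations R M N"
  "\<lbrakk>u \<in> carrier M; v \<in> carrier N; v' \<in> carrier N\<rbrakk> \<Longrightarrow>
    free_basis R (u, v \<oplus>\<^bsub>N\<^esub> v') \<ominus>\<^bsub>L\<^esub> (free_basis R (u, v) \<oplus>\<^bsub>L\<^esub> free_basis R (u, v'))
      \<in> tensor_relations R M N"
  "\<lbrakk>c \<in> carrier R; u \<in> carrier M; v \<in> carrier N\<rbrakk> \<Longrightarrow>
    free_basis R (c \<odot>\<^bsub>M\<^esub> u, v) \<ominus>\<^bsub>L\<^esub> c \<odot>\<^bsub>L\<^esub> free_basis R (u, v) \<in> tensor_relations R M N"
  "\<lbrakk>c \<in> carrier R; u \<in> carrier M; v \<in> carrier N\<rbrakk> \<Longrightarrow>
    free_basis R (u, c \<odot>\<^bsub>N\<^esub> v) \<ominus>\<^bsub>L\<^esub> c \<odot>\<^bsub>L\<^esub> free_basis R (u, v) \<in> tensor_relations R M N"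
  unfolding tensor_relations_def Let_def by (rule subsetD[OF span_superset], blast)+

sublocale Q: quotient_module R L "tensor_relations R M N"
  by (simp add: quotient_module_def quotient_module_axioms_def module_L submodule_relations)

lemma module_tensor: "module R T"
  using Q.module_quot by (simp add: tensor_module_def)

sublocale T: module R T by (rule module_tensor)

lemma proj_hom: "module_hom R L T (\<lambda>u. tensor_relations R M N +>\<^bsub>L\<^esub> u)"
  using Q.module_hom_quot by (simp add: tensor_module_def)

sublocale proj: module_hom R L T "\<lambda>u. tensor_relations R M N +>\<^bsub>L\<^esub> u"
  by (rule proj_hom)

lemma tensor_closed: "\<lbrakk>u \<in> carrier M; v \<in> carrier N\<rbrakk> \<Longrightarrow> tensor u v \<in> carrier T"
  by (simp add: pure_tensor_def proj.hom_closed basis_closed)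

lemma tensor_add_left:
  assumes "u \<in> carrier M" "u' \<in> carrier M" "v \<in> carrier N"
  shows "tensor (u \<oplus>\<^bsub>M\<^esub> u') v = tensor u v \<oplus>\<^bsub>T\<^esub> tensor u' v"
  using assms relations(1)[OF assms]
  by (simp add: pure_tensor_def proj.hom_add[symmetric] Q.quot_eq_iff basis_closed)

lemma tensor_add_right:
  assumes "u \<in> carrier M" "v \<in> carrier N" "v' \<in> carrier N"
  shows "tensor u (v \<oplus>\<^bsub>N\<^esub> v') = tensor u v \<oplus>\<^bsub>T\<^esub> tensor u v'"
  using assms relations(2)[OF assms]
  by (simp add: pure_tensor_def proj.hom_add[symmetric] Q.quot_eq_iff basis_closed)

lemma tensor_smult_left:
  assumes "c \<in> carrier R" "u \<in> carrier M" "v \<in> carrier N"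
  shows "tensor (c \<odot>\<^bsub>M\<^esub> u) v = c \<odot>\<^bsub>T\<^esub> tensor u v"
  using assms relations(3)[OF assms]
  by (simp add: pure_tensor_def proj.hom_smult[symmetric] Q.quot_eq_iff basis_closed)

lemma tensor_smult_right:
  assumes "c \<in> carrier R" "u \<in> carrier M" "v \<in> carrier N"
  shows "tensor u (c \<odot>\<^bsub>N\<^esub> v) = c \<odot>\<^bsub>T\<^esub> tensor u v"
  using assms relations(4)[OF assms]
  by (simp add: pure_tensor_def proj.hom_smult[symmetric] Q.quot_eq_iff basis_closed)

text \<open>Makes \<open>hom_finsum\<close> available in the second slot, where the Leibniz rule of
  the connection collects a sum into one tensor.\<close>

lemma tensor_hom_right:
  assumes "u \<in> carrier M"
  shows "module_hom R N T (tensor u)"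
  unfolding module_hom_def module_hom_axioms_def
  using assms N.module_axioms module_tensor
  by (simp add: tensor_closed tensor_add_right tensor_smult_right)

end


section \<open>Derivations\<close>

text \<open>Derivations of P with values in a C-module regarded as a P-module through q. Both
  \<open>d\<close> composed with q and the map that induces the splitting are of this kind, so the
  rules are proved once.\<close>

locale derivation = ring_hom_cring P C q + M: module C M
  for P (structure) and C (structure) and q and M and D +
  assumes D_closed: "f \<in> carrier P \<Longrightarrow> D f \<in> carrier M"
    and D_add: "\<lbrakk>f \<in> carrier P; g \<in> carrier P\<rbrakk> \<Longrightarrow> D (f \<oplus> g) = D f \<oplus>\<^bsub>M\<^esub> D g"
    and D_mult: "\<lbrakk>f \<in> carrier P; g \<in> carrier P\<rbrakk>
      \<Longrightarrow> D (f \<otimes> g) = q f \<odot>\<^bsub>M\<^esub> D g \<oplus>\<^bsub>M\<^esub> q g \<odot>\<^bsub>M\<^esub> D f"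
begin

lemma D_zero: "D \<zero> = \<zero>\<^bsub>M\<^esub>"
  using D_mult[of \<zero> \<zero>] by (simp add: D_closed)

lemma D_one: "D \<one> = \<zero>\<^bsub>M\<^esub>"
proof -
  have "D \<one> = D \<one> \<oplus>\<^bsub>M\<^esub> D \<one>"
    using D_mult[of \<one> \<one>] by (simp add: D_closed)
  then show ?thesis
    by (metis D_closed M.M.add.r_cancel_one' R.one_closed)
qed

lemma D_neg:
  assumes "f \<in> carrier P"
  shows "D (\<ominus> f) = \<ominus>\<^bsub>M\<^esub> D f"
proof -
  have "D (\<ominus> f) \<oplus>\<^bsub>M\<^esub> D f = \<zero>\<^bsub>M\<^esub>"
    using assms by (simp add: D_add[symmetric] D_zero R.l_neg)
  then show ?thesis
    using assms by (simp add: M.M.minus_equality D_closed)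
qed

lemma D_minus: "\<lbrakk>f \<in> carrier P; g \<in> carrier P\<rbrakk> \<Longrightarrow> D (f \<ominus> g) = D f \<ominus>\<^bsub>M\<^esub> D g"
  by (simp add: a_minus_def D_add D_neg)

lemma D_finsum:
  assumes "f \<in> I \<rightarrow> carrier P"
  shows "D (\<Oplus>i\<in>I. f i) = (\<Oplus>\<^bsub>M\<^esub>i\<in>I. D (f i))"
  using assms
  by (induct I rule: infinite_finite_induct) (auto simp: D_zero D_add D_closed Pi_def)

text \<open>Induction with the product rule. At n = 0 the truncated exponent n - 1 is harmless
  because the multiple [0] makes the right side zero.\<close>

lemma D_pow:
  fixes n :: nat
  assumes f: "f \<in> carrier P"
  shows "D (f [^] n) = ([n] \<cdot>\<^bsub>C\<^esub> (q f [^]\<^bsub>C\<^esub> (n - 1))) \<odot>\<^bsub>M\<^esub> D f"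
proof (induction n)
  case 0
  then show ?case using f by (simp add: D_one D_closed)
next
  case (Suc n)
  have q_pow: "q (f [^] n) = q f [^]\<^bsub>C\<^esub> n"
    using f by (induction n) auto
  have pow: "q f \<otimes>\<^bsub>C\<^esub> ([n] \<cdot>\<^bsub>C\<^esub> (q f [^]\<^bsub>C\<^esub> (n - 1))) = [n] \<cdot>\<^bsub>C\<^esub> (q f [^]\<^bsub>C\<^esub> n)"
    using f by (cases n) (auto simp: S.add_pow_rdistr S.m_comm S.r_distr)
  have "D (f [^] Suc n) = q f [^]\<^bsub>C\<^esub> n \<odot>\<^bsub>M\<^esub> D f \<oplus>\<^bsub>M\<^esub> q f \<odot>\<^bsub>M\<^esub> D (f [^] n)"
    using f by (simp add: D_mult q_pow)
  also have "q f \<odot>\<^bsub>M\<^esub> D (f [^] n) = ([n] \<cdot>\<^bsub>C\<^esub> (q f [^]\<^bsub>C\<^esub> n)) \<odot>\<^bsub>M\<^esub> D f"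
    using f by (simp add: Suc.IH D_closed M.smult_assoc1[symmetric] pow[unfolded One_nat_def])
  also have "q f [^]\<^bsub>C\<^esub> n \<odot>\<^bsub>M\<^esub> D f \<oplus>\<^bsub>M\<^esub> ([n] \<cdot>\<^bsub>C\<^esub> (q f [^]\<^bsub>C\<^esub> n)) \<odot>\<^bsub>M\<^esub> D f
      = ([Suc n] \<cdot>\<^bsub>C\<^esub> (q f [^]\<^bsub>C\<^esub> n)) \<odot>\<^bsub>M\<^esub> D f"
    using f by (simp add: M.smult_l_distr[symmetric] D_closed S.a_comm)
  finally show ?case by simp
qed

end

section \<open>Derivations on a polynomial ring in finitely many variables\<close>

context cring
begin

text \<open>The right side obeys the same rules for constants, sums and multiplication by a variable
  as D does. Applied to \<open>d\<close> composed with q, it expresses every differential through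
  those of the variables.\<close>

lemma derivation_mpoly_eq:
  assumes "derivation (mpoly_ring R I) C q M D" and fin: "finite I"
    and const: "\<And>a. a \<in> carrier R \<Longrightarrow> D (indexed_const a) = \<zero>\<^bsub>M\<^esub>"
    and f: "f \<in> carrier (mpoly_ring R I)"
  shows "D f = (\<Oplus>\<^bsub>M\<^esub>j\<in>I. q (mpoly_pderiv R j f) \<odot>\<^bsub>M\<^esub> D (indexed_var j))"
proof -
  interpret D: derivation "mpoly_ring R I" C q M D by fact
  note closed [simp] = mpoly_pderiv_closed[where I = I] indexed_var_closed[of _ I] D.D_closed
  show ?thesis
    using f
  proof (induction rule: mpoly_ring_induct)
    case (const a)
    then have "mpoly_pderiv R j (indexed_const a) = \<zero>\<^bsub>mpoly_ring R I\<^esub>" for j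
      by (simp add: mpoly_pderiv_const mpoly_ring_simps)
    then have "(\<Oplus>\<^bsub>M\<^esub>j\<in>I. q (mpoly_pderiv R j (indexed_const a)) \<odot>\<^bsub>M\<^esub> D (indexed_var j))
        = \<zero>\<^bsub>M\<^esub>"
      by (intro D.M.M.add.finprod_one_eqI) simp
    then show ?case using const assms(3) by simp
  next
    case (add f g)
    have "(\<Oplus>\<^bsub>M\<^esub>j\<in>I. q (mpoly_pderiv R j (f \<oplus>\<^bsub>mpoly_ring R I\<^esub> g)) \<odot>\<^bsub>M\<^esub> D (indexed_var j))
      = (\<Oplus>\<^bsub>M\<^esub>j\<in>I. q (mpoly_pderiv R j f) \<odot>\<^bsub>M\<^esub> D (indexed_var j)
          \<oplus>\<^bsub>M\<^esub> q (mpoly_pderiv R j g) \<odot>\<^bsub>M\<^esub> D (indexed_var j))"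
      using add.hyps
      by (intro D.M.M.add.finprod_cong') (auto simp: mpoly_pderiv_ring_add D.M.smult_l_distr)
    also have "\<dots> = D f \<oplus>\<^bsub>M\<^esub> D g"
      using add.hyps by (subst D.M.M.finsum_addf) (auto simp: add.IH[symmetric])
    finally show ?case using add.hyps by (simp add: D.D_add)
  next
    case (var_mult f i)
    have "(\<Oplus>\<^bsub>M\<^esub>j\<in>I. q (mpoly_pderiv R j (indexed_var i \<otimes>\<^bsub>mpoly_ring R I\<^esub> f)) \<odot>\<^bsub>M\<^esub> D (indexed_var j))
      = (\<Oplus>\<^bsub>M\<^esub>j\<in>I. q (indexed_var i) \<odot>\<^bsub>M\<^esub> (q (mpoly_pderiv R j f) \<odot>\<^bsub>M\<^esub> D (indexed_var j))
          \<oplus>\<^bsub>M\<^esub> (if j = i then q f \<odot>\<^bsub>M\<^esub> D (indexed_var j) else \<zero>\<^bsub>M\<^esub>))"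
      using var_mult.hyps
      by (intro D.M.M.add.finprod_cong')
        (auto simp: mpoly_pderiv_var_mult D.M.smult_l_distr D.M.smult_assoc1)
    also have "\<dots> = (\<Oplus>\<^bsub>M\<^esub>j\<in>I. q (indexed_var i) \<odot>\<^bsub>M\<^esub> (q (mpoly_pderiv R j f) \<odot>\<^bsub>M\<^esub> D (indexed_var j)))
        \<oplus>\<^bsub>M\<^esub> (\<Oplus>\<^bsub>M\<^esub>j\<in>I. if j = i then q f \<odot>\<^bsub>M\<^esub> D (indexed_var j) else \<zero>\<^bsub>M\<^esub>)"
      using var_mult.hyps by (intro D.M.M.finsum_addf) auto
    also have "(\<Oplus>\<^bsub>M\<^esub>j\<in>I. if j = i then q f \<odot>\<^bsub>M\<^esub> D (indexed_var j) else \<zero>\<^bsub>M\<^esub>)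
        = q f \<odot>\<^bsub>M\<^esub> D (indexed_var i)"
      using var_mult.hyps fin by (intro D.M.M.add.finprod_singleton_swap) auto
    also have "(\<Oplus>\<^bsub>M\<^esub>j\<in>I. q (indexed_var i) \<odot>\<^bsub>M\<^esub> (q (mpoly_pderiv R j f) \<odot>\<^bsub>M\<^esub> D (indexed_var j)))
        = q (indexed_var i) \<odot>\<^bsub>M\<^esub> D f"
      using var_mult.hyps fin
      by (subst D.M.finsum_smult_ldistr[symmetric]) (auto simp: var_mult.IH[symmetric])
    finally show ?case using var_mult.hyps by (simp add: D.D_mult)
  qed
qed

text \<open>The formula of \<open>derivation_mpoly_eq\<close>, with t j in place of the value at the
  j-th variable, serves as the definition. The product rule is inherited from the partial
  derivatives, and the prescribed values appear because the derivatives of a variable are 1 and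
  0.\<close>

lemma derivation_mpoly_exists:
  assumes "ring_hom_cring (mpoly_ring R I) C q" and "module C M" and fin: "finite I"
    and t: "\<And>j. j \<in> I \<Longrightarrow> t j \<in> carrier M"
  obtains D where "derivation (mpoly_ring R I) C q M D"
    and "\<And>j. j \<in> I \<Longrightarrow> D (indexed_var j) = t j"
    and "\<And>a. a \<in> carrier R \<Longrightarrow> D (indexed_const a) = \<zero>\<^bsub>M\<^esub>"
proof -
  interpret q: ring_hom_cring "mpoly_ring R I" C q by fact
  interpret M: module C M by fact
  note closed [simp] = mpoly_pderiv_closed[where I = I] indexed_var_closed[of _ I] t
  define D where "D = (\<lambda>f. \<Oplus>\<^bsub>M\<^esub>j\<in>I. q (mpoly_pderiv R j f) \<odot>\<^bsub>M\<^esub> t j)"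
  have "derivation (mpoly_ring R I) C q M D"
  proof
    fix f g assume f: "f \<in> carrier (mpoly_ring R I)" and g: "g \<in> carrier (mpoly_ring R I)"
    show "D f \<in> carrier M"
      unfolding D_def using f by (intro M.M.finsum_closed) auto
    have "D (f \<oplus>\<^bsub>mpoly_ring R I\<^esub> g) = (\<Oplus>\<^bsub>M\<^esub>j\<in>I. q (mpoly_pderiv R j f) \<odot>\<^bsub>M\<^esub> t j
          \<oplus>\<^bsub>M\<^esub> q (mpoly_pderiv R j g) \<odot>\<^bsub>M\<^esub> t j)"
      unfolding D_def using f g
      by (intro M.M.add.finprod_cong') (auto simp: mpoly_pderiv_ring_add M.smult_l_distr)
    also have "\<dots> = D f \<oplus>\<^bsub>M\<^esub> D g"
      unfolding D_def using f g by (intro M.M.finsum_addf) auto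
    finally show "D (f \<oplus>\<^bsub>mpoly_ring R I\<^esub> g) = D f \<oplus>\<^bsub>M\<^esub> D g" .
    have "D (f \<otimes>\<^bsub>mpoly_ring R I\<^esub> g) = (\<Oplus>\<^bsub>M\<^esub>j\<in>I. q f \<odot>\<^bsub>M\<^esub> (q (mpoly_pderiv R j g) \<odot>\<^bsub>M\<^esub> t j)
          \<oplus>\<^bsub>M\<^esub> q g \<odot>\<^bsub>M\<^esub> (q (mpoly_pderiv R j f) \<odot>\<^bsub>M\<^esub> t j))"
      unfolding D_def using f g
      by (intro M.M.add.finprod_cong')
        (auto simp: mpoly_pderiv_mult M.smult_l_distr M.smult_assoc1)
    also have "\<dots> = (\<Oplus>\<^bsub>M\<^esub>j\<in>I. q f \<odot>\<^bsub>M\<^esub> (q (mpoly_pderiv R j g) \<odot>\<^bsub>M\<^esub> t j))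
          \<oplus>\<^bsub>M\<^esub> (\<Oplus>\<^bsub>M\<^esub>j\<in>I. q g \<odot>\<^bsub>M\<^esub> (q (mpoly_pderiv R j f) \<odot>\<^bsub>M\<^esub> t j))"
      using f g by (intro M.M.finsum_addf) auto
    also have "\<dots> = q f \<odot>\<^bsub>M\<^esub> D g \<oplus>\<^bsub>M\<^esub> q g \<odot>\<^bsub>M\<^esub> D f"
      unfolding D_def using f g fin by (subst (1 2) M.finsum_smult_ldistr) auto
    finally show "D (f \<otimes>\<^bsub>mpoly_ring R I\<^esub> g) = q f \<odot>\<^bsub>M\<^esub> D g \<oplus>\<^bsub>M\<^esub> q g \<odot>\<^bsub>M\<^esub> D f" .
  qed
  moreover have "D (indexed_var j) = t j" if j: "j \<in> I" for j
  proof -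
    have "D (indexed_var j) = (\<Oplus>\<^bsub>M\<^esub>i\<in>I. if i = j then t i else \<zero>\<^bsub>M\<^esub>)"
      unfolding D_def using j by (intro M.M.add.finprod_cong') (auto simp: mpoly_pderiv_var[OF j])
    also have "\<dots> = t j"
      using j fin by (intro M.M.add.finprod_singleton_swap) auto
    finally show ?thesis .
  qed
  moreover have "D (indexed_const a) = \<zero>\<^bsub>M\<^esub>" if "a \<in> carrier R" for a
  proof -
    have "mpoly_pderiv R j (indexed_const a) = \<zero>\<^bsub>mpoly_ring R I\<^esub>" for j
      using that by (simp add: mpoly_pderiv_const mpoly_ring_simps)
    then show ?thesis
      unfolding D_def by (intro M.M.add.finprod_one_eqI) simp
  qed
  ultimately show thesis using that by blast
qed

end

section \<open>Passage to the quotient by a principal ideal\<close>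

lemma (in derivation) factor:
  assumes ker: "\<And>f. \<lbrakk>f \<in> carrier P; q f = \<zero>\<^bsub>C\<^esub>\<rbrakk> \<Longrightarrow> D f = \<zero>\<^bsub>M\<^esub>"
  obtains D' where "\<And>f. f \<in> carrier P \<Longrightarrow> D' (q f) = D f"
proof -
  \<comment> \<open>D is evaluated at a chosen preimage. Two preimages differ by an element of the
    kernel of q, where D vanishes, so on the image of q the choice has no effect.\<close>
  define D' where "D' = (\<lambda>c. D (SOME f. f \<in> carrier P \<and> q f = c))"
  have "D' (q f) = D f" if f: "f \<in> carrier P" for f
  proof -
    define g where "g = (SOME g. g \<in> carrier P \<and> q g = q f)"
    have g: "g \<in> carrier P" "q g = q f"
      using someI[of "\<lambda>g. g \<in> carrier P \<and> q g = q f" f] f by (auto simp: g_def)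
    have "q (g \<ominus> f) = \<zero>\<^bsub>C\<^esub>"
      using f g by (simp add: a_minus_def S.r_neg)
    then have "D g \<ominus>\<^bsub>M\<^esub> D f = \<zero>\<^bsub>M\<^esub>"
      using f g by (simp add: ker D_minus[symmetric])
    then show ?thesis
      using f g by (simp add: M.minus_eq_zero_iff D_closed D'_def g_def)
  qed
  then show thesis using that by blast
qed

text \<open>Presents the quotient as a surjective ring homomorphism whose kernel is the multiples of
  H, the only form in which C enters the geometric argument.\<close>

lemma (in cring) principal_quotient:
  assumes H: "H \<in> carrier R"
  defines "q \<equiv> \<lambda>f. PIdl H +> f"
  shows "ring_hom_cring R (R Quot PIdl H) q"
    and "carrier (R Quot PIdl H) = q ` carrier R"
    and "f \<in> carrier R \<Longrightarrow> q f = \<zero>\<^bsub>R Quot PIdl H\<^esub> \<longleftrightarrow> (\<exists>g\<in>carrier R. f = g \<otimes> H)"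
proof -
  interpret J: ideal "PIdl H" R by (rule cgenideal_ideal[OF H])
  show "ring_hom_cring R (R Quot PIdl H) q"
    unfolding q_def by (rule J.rcos_ring_hom_cring) (rule is_cring)
  show "carrier (R Quot PIdl H) = q ` carrier R"
    unfolding q_def FactRing_def A_RCOSETS_def' by auto
  assume f: "f \<in> carrier R"
  have "q f = PIdl H \<longleftrightarrow> f \<in> PIdl H"
  proof
    assume "q f = PIdl H"
    then show "f \<in> PIdl H" using J.a_rcos_self[OF f] by (simp add: q_def)
  next
    assume "f \<in> PIdl H"
    then show "q f = PIdl H" unfolding q_def by (rule J.a_rcos_const)
  qed
  moreover have "\<zero>\<^bsub>R Quot PIdl H\<^esub> = PIdl H" by (simp add: FactRing_def)
  moreover have "f \<in> PIdl H \<longleftrightarrow> (\<exists>g\<in>carrier R. f = g \<otimes> H)"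
    unfolding cgenideal_def by blast
  ultimately show "q f = \<zero>\<^bsub>R Quot PIdl H\<^esub> \<longleftrightarrow> (\<exists>g\<in>carrier R. f = g \<otimes> H)"
    by (simp only:)
qed


section \<open>The Fermat hypersurface\<close>

text \<open>C is given only through a surjection q with kernel (H), and a i stands for 1/p_i. In
  this form the argument involves neither cosets nor rational scalars.\<close>

locale fermat_quotient = R: cring R + q: ring_hom_cring "mpoly_ring R I" C q
  for R (structure) and I :: "'i set" and C and q +
  fixes p :: "'i \<Rightarrow> nat" and a :: "'i \<Rightarrow> 'a" and H
  assumes fin: "finite I"
    and p_pos: "i \<in> I \<Longrightarrow> p i \<ge> 1"
    and a_closed: "i \<in> I \<Longrightarrow> a i \<in> carrier R"
    and a_inverse: "i \<in> I \<Longrightarrow> [p i] \<cdot> a i = \<one>"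
    and H: "H = (\<Oplus>\<^bsub>mpoly_ring R I\<^esub>i\<in>I. R.indexed_var i [^]\<^bsub>mpoly_ring R I\<^esub> p i)
      \<ominus>\<^bsub>mpoly_ring R I\<^esub> \<one>\<^bsub>mpoly_ring R I\<^esub>"
    and q_surj: "carrier C = q ` carrier (mpoly_ring R I)"
    and q_ker: "f \<in> carrier (mpoly_ring R I) \<Longrightarrow>
      q f = \<zero>\<^bsub>C\<^esub> \<longleftrightarrow> (\<exists>g\<in>carrier (mpoly_ring R I). f = g \<otimes>\<^bsub>mpoly_ring R I\<^esub> H)"
begin

abbreviation "P \<equiv> mpoly_ring R I"
abbreviation "indet \<equiv> R.indexed_var"
definition "\<phi> = (\<lambda>r. q (R.indexed_const r))"
definition "x = (\<lambda>i. q (indet i))"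
abbreviation "\<Omega> \<equiv> kaehler R C \<phi>"
abbreviation "d \<equiv> kaehler_d R C \<phi>"
definition "w = (\<lambda>i. d (x i))"
abbreviation "F \<equiv> free_module C I"
abbreviation "e \<equiv> free_basis C"
text \<open>
  \<open>c i\<close> is the class of the partial derivative of \<open>H\<close> by the \<open>i\<close>-th variable, and \<open>t i\<close> is the value
  prescribed for the splitting at \<open>w i\<close>.
\<close>

definition "c = (\<lambda>i. [p i] \<cdot>\<^bsub>C\<^esub> (x i [^]\<^bsub>C\<^esub> (p i - 1)))"
definition "G = (\<Oplus>\<^bsub>F\<^esub>i\<in>I. c i \<odot>\<^bsub>F\<^esub> e i)"
definition "t = (\<lambda>i. e i \<ominus>\<^bsub>F\<^esub> (\<phi> (a i) \<otimes>\<^bsub>C\<^esub> x i) \<odot>\<^bsub>F\<^esub> G)"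
abbreviation "S \<equiv> {s \<in> module_homs C \<Omega> F. \<forall>i\<in>I. s (w i) = t i}"

lemma indet_closed: "i \<in> I \<Longrightarrow> indet i \<in> carrier P"
  by (rule R.indexed_var_closed)

lemma \<phi>_closed: "r \<in> carrier R \<Longrightarrow> \<phi> r \<in> carrier C"
  by (simp add: \<phi>_def R.indexed_const_closed)

lemma x_closed: "i \<in> I \<Longrightarrow> x i \<in> carrier C"
  by (simp add: x_def indet_closed)

lemma c_closed: "i \<in> I \<Longrightarrow> c i \<in> carrier C"
  by (simp add: c_def x_closed)

sublocale K: kaehler_differentials C R \<phi>
  by (simp add: kaehler_differentials_def kaehler_differentials_axioms_def q.S.is_cring \<phi>_closed)

sublocale F: module C F by (rule q.S.module_free_module)

lemma w_closed: "i \<in> I \<Longrightarrow> w i \<in> carrier \<Omega>"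
  by (simp add: w_def x_closed K.d_closed)

lemma e_closed: "i \<in> I \<Longrightarrow> e i \<in> carrier F"
  by (rule q.S.free_basis_closed)

lemma G_closed: "G \<in> carrier F"
  unfolding G_def by (intro F.M.finsum_closed) (auto simp: c_closed e_closed)

lemma t_closed: "i \<in> I \<Longrightarrow> t i \<in> carrier F"
  by (simp add: t_def e_closed G_closed a_closed \<phi>_closed x_closed)

section \<open>The equation of the hypersurface in C and its differential\<close>

lemma sum_closed: "(\<Oplus>\<^bsub>P\<^esub>i\<in>I. indet i [^]\<^bsub>P\<^esub> p i) \<in> carrier P"
  by (intro q.R.finsum_closed) (auto simp: indet_closed)

lemma H_closed: "H \<in> carrier P"
  unfolding H by (intro q.R.minus_closed sum_closed q.R.one_closed)

lemma q_H: "q H = \<zero>\<^bsub>C\<^esub>"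
  using q_ker[OF H_closed] q.R.l_one[OF H_closed] q.R.one_closed by metis

lemma q_pow: "f \<in> carrier P \<Longrightarrow> q (f [^]\<^bsub>P\<^esub> (n::nat)) = q f [^]\<^bsub>C\<^esub> n"
  by (induction n) auto

text \<open>This is q H = 0 read in C. It gives the Euler functional the value 1 at G, and
  \<open>relation_t\<close> rests on it.\<close>

lemma sum_pow: "(\<Oplus>\<^bsub>C\<^esub>i\<in>I. x i [^]\<^bsub>C\<^esub> p i) = \<one>\<^bsub>C\<^esub>"
proof -
  have "q (\<Oplus>\<^bsub>P\<^esub>i\<in>I. indet i [^]\<^bsub>P\<^esub> p i) = (\<Oplus>\<^bsub>C\<^esub>i\<in>I. (q \<circ> (\<lambda>i. indet i [^]\<^bsub>P\<^esub> p i)) i)"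
    by (rule q.hom_finsum) (auto simp: indet_closed)
  also have "\<dots> = (\<Oplus>\<^bsub>C\<^esub>i\<in>I. x i [^]\<^bsub>C\<^esub> p i)"
    by (intro q.S.add.finprod_cong') (auto simp: q_pow indet_closed x_def)
  finally have sum: "q (\<Oplus>\<^bsub>P\<^esub>i\<in>I. indet i [^]\<^bsub>P\<^esub> p i) = (\<Oplus>\<^bsub>C\<^esub>i\<in>I. x i [^]\<^bsub>C\<^esub> p i)" .
  have "q H = q (\<Oplus>\<^bsub>P\<^esub>i\<in>I. indet i [^]\<^bsub>P\<^esub> p i) \<ominus>\<^bsub>C\<^esub> \<one>\<^bsub>C\<^esub>"
    unfolding H a_minus_def using sum_closed by simp
  then have "(\<Oplus>\<^bsub>C\<^esub>i\<in>I. x i [^]\<^bsub>C\<^esub> p i) \<ominus>\<^bsub>C\<^esub> \<one>\<^bsub>C\<^esub> = \<zero>\<^bsub>C\<^esub>"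
    by (simp only: q_H sum)
  then show ?thesis
    using q.S.minus_eq_zero_iff[of "\<Oplus>\<^bsub>C\<^esub>i\<in>I. x i [^]\<^bsub>C\<^esub> p i" "\<one>\<^bsub>C\<^esub>"] x_closed
    by (simp add: Pi_def q.S.finsum_closed)
qed

text \<open>Stated for an arbitrary derivation because it is needed twice: for \<open>d\<close>
  composed with q it yields the relation among the w i, and for the derivation with values t i it
  turns D H = 0 into \<open>relation_t\<close>.\<close>

lemma derivation_H:
  assumes "derivation P C q M D"
  shows "D H = (\<Oplus>\<^bsub>M\<^esub>i\<in>I. c i \<odot>\<^bsub>M\<^esub> D (indet i))"
proof -
  interpret D: derivation P C q M D by fact
  have "D H = D (\<Oplus>\<^bsub>P\<^esub>i\<in>I. indet i [^]\<^bsub>P\<^esub> p i)"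
    unfolding H using D.D_minus[OF sum_closed q.R.one_closed] D.D_closed[OF sum_closed]
    by (simp add: D.D_one a_minus_def)
  also have "\<dots> = (\<Oplus>\<^bsub>M\<^esub>i\<in>I. D (indet i [^]\<^bsub>P\<^esub> p i))"
    by (rule D.D_finsum) (auto simp: indet_closed)
  also have "\<dots> = (\<Oplus>\<^bsub>M\<^esub>i\<in>I. c i \<odot>\<^bsub>M\<^esub> D (indet i))"
    by (intro D.M.M.add.finprod_cong')
      (auto simp: D.D_pow indet_closed c_def x_def D.D_closed)
  finally show ?thesis .
qed

section \<open>Generators of \<Omega> and the relation between them\<close>

lemma derivation_dq: "derivation P C q \<Omega> (\<lambda>f. d (q f))"
  unfolding derivation_def derivation_axioms_def
  using K.module_kaehler q.ring_hom_cring_axioms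
  by (simp add: K.d_closed K.d_add K.d_mult)

lemma dq_eq:
  assumes "f \<in> carrier P"
  shows "d (q f) = (\<Oplus>\<^bsub>\<Omega>\<^esub>i\<in>I. q (mpoly_pderiv R i f) \<odot>\<^bsub>\<Omega>\<^esub> w i)"
  using R.derivation_mpoly_eq[OF derivation_dq fin _ assms] K.d_scalar
  by (simp add: w_def x_def \<phi>_def)

lemma relation_w: "(\<Oplus>\<^bsub>\<Omega>\<^esub>i\<in>I. c i \<odot>\<^bsub>\<Omega>\<^esub> w i) = \<zero>\<^bsub>\<Omega>\<^esub>"
proof -
  interpret dq: derivation P C q \<Omega> "\<lambda>f. d (q f)" by (rule derivation_dq)
  \<comment> \<open>H and 0 have the same image under q. The left side is the sum in question by
    \<open>derivation_H\<close>, and the right side vanishes by \<open>D_zero\<close>.\<close>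
  have "d (q H) = d (q \<zero>\<^bsub>P\<^esub>)" by (simp only: q_H q.hom_zero)
  then show ?thesis
    using derivation_H[OF derivation_dq] by (simp only: dq.D_zero w_def x_def)
qed

text \<open>Every element of C is some q f, and \<open>dq_eq\<close> writes its differential as a
  combination of the w i. This is the generation of \<Omega>, used both for uniqueness of the
  splitting and for identifying r o s with the identity.\<close>

lemma hom_eqI:
  assumes s: "module_hom C \<Omega> M s" and s': "module_hom C \<Omega> M s'"
    and eq: "\<And>i. i \<in> I \<Longrightarrow> s (w i) = s' (w i)" and u: "u \<in> carrier \<Omega>"
  shows "s u = s' u"
proof (rule K.kaehler_hom_eqI[OF s s' _ u])
  interpret s: module_hom C \<Omega> M s by (rule s)
  interpret s': module_hom C \<Omega> M s' by (rule s')
  fix b assume "b \<in> carrier C"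
  then obtain f where f: "f \<in> carrier P" "b = q f" using q_surj by blast
  have "s (d (q f)) = (\<Oplus>\<^bsub>M\<^esub>i\<in>I. s (q (mpoly_pderiv R i f) \<odot>\<^bsub>\<Omega>\<^esub> w i))"
    unfolding dq_eq[OF f(1)]
    by (rule s.hom_finsum) (auto simp: w_closed R.mpoly_pderiv_closed f)
  also have "\<dots> = (\<Oplus>\<^bsub>M\<^esub>i\<in>I. s' (q (mpoly_pderiv R i f) \<odot>\<^bsub>\<Omega>\<^esub> w i))"
    by (intro s.N.M.add.finprod_cong')
      (auto simp: w_closed R.mpoly_pderiv_closed f s.hom_smult s'.hom_smult eq s'.hom_closed)
  also have "\<dots> = s' (d (q f))"
    unfolding dq_eq[OF f(1)]
    by (rule s'.hom_finsum[symmetric]) (auto simp: w_closed R.mpoly_pderiv_closed f)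
  finally show "s (d b) = s' (d b)" by (simp add: f)
qed

section \<open>Existence and uniqueness of the splitting\<close>

lemma c_inverse:
  assumes i: "i \<in> I"
  shows "c i \<otimes>\<^bsub>C\<^esub> (\<phi> (a i) \<otimes>\<^bsub>C\<^esub> x i) = x i [^]\<^bsub>C\<^esub> p i"
proof -
  \<comment> \<open>Natural multiples pass through \<open>\<phi>\<close>, so the identity p_i a_i =
    1 carries over from the ground ring to C.\<close>
  have \<phi>_pow: "[n] \<cdot>\<^bsub>C\<^esub> \<phi> (a i) = \<phi> ([n] \<cdot> a i)" for n :: nat
  proof (induction n)
    case 0
    show ?case
      using q.hom_zero by (simp add: \<phi>_def R.mpoly_ring_simps(4))
  next
    case (Suc n)
    have "\<phi> ([n] \<cdot> a i \<oplus> a i) = \<phi> ([n] \<cdot> a i) \<oplus>\<^bsub>C\<^esub> \<phi> (a i)"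
      using q.hom_add[of "R.indexed_const ([n] \<cdot> a i)" "R.indexed_const (a i)"] a_closed[OF i]
      by (simp add: \<phi>_def R.indexed_const_closed R.mpoly_ring_simps(5) R.indexed_padd_const)
    then show ?case by (simp add: Suc)
  qed
  have "\<phi> \<one> = \<one>\<^bsub>C\<^esub>" using q.hom_one by (simp add: \<phi>_def R.mpoly_ring_simps(3))
  then have inv: "[p i] \<cdot>\<^bsub>C\<^esub> \<phi> (a i) = \<one>\<^bsub>C\<^esub>" by (simp add: \<phi>_pow a_inverse[OF i])
  note [simp] = \<phi>_closed[OF a_closed[OF i]] x_closed[OF i]
  have "c i \<otimes>\<^bsub>C\<^esub> (\<phi> (a i) \<otimes>\<^bsub>C\<^esub> x i)
      = ([p i] \<cdot>\<^bsub>C\<^esub> \<phi> (a i)) \<otimes>\<^bsub>C\<^esub> (x i [^]\<^bsub>C\<^esub> (p i - 1) \<otimes>\<^bsub>C\<^esub> x i)"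
    unfolding c_def by (simp add: q.S.add_pow_ldistr q.S.add_pow_rdistr q.S.m_ac)
  also have "\<dots> = x i [^]\<^bsub>C\<^esub> Suc (p i - 1)" by (simp add: inv)
  \<comment> \<open>The truncated subtraction is undone here, which requires p_i to be
    positive.\<close>
  also have "Suc (p i - 1) = p i" using p_pos[OF i] by simp
  finally show ?thesis .
qed

text \<open>Instead of expanding the differences t i, one substitutes e_i = t_i + (x_i/p_i) G into
  G. This gives G = z + (sum_i x_i^p_i) G = z + G for the sum z in question, and G cancels.\<close>

lemma relation_t: "(\<Oplus>\<^bsub>F\<^esub>i\<in>I. c i \<odot>\<^bsub>F\<^esub> t i) = \<zero>\<^bsub>F\<^esub>"
proof -
  note [simp] = c_closed t_closed x_closed e_closed G_closed a_closed \<phi>_closed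
  let ?z = "\<Oplus>\<^bsub>F\<^esub>i\<in>I. c i \<odot>\<^bsub>F\<^esub> t i"
  have z: "?z \<in> carrier F" by (intro F.M.finsum_closed) auto
  have "G = (\<Oplus>\<^bsub>F\<^esub>i\<in>I. c i \<odot>\<^bsub>F\<^esub> t i \<oplus>\<^bsub>F\<^esub> x i [^]\<^bsub>C\<^esub> p i \<odot>\<^bsub>F\<^esub> G)"
  proof (subst G_def, intro F.M.add.finprod_cong')
    fix i assume i: "i \<in> I"
    have "t i \<oplus>\<^bsub>F\<^esub> (\<phi> (a i) \<otimes>\<^bsub>C\<^esub> x i) \<odot>\<^bsub>F\<^esub> G = e i"
      using i by (simp add: t_def a_minus_def F.M.a_assoc F.M.l_neg)
    then have "c i \<odot>\<^bsub>F\<^esub> e i = c i \<odot>\<^bsub>F\<^esub> (t i \<oplus>\<^bsub>F\<^esub> (\<phi> (a i) \<otimes>\<^bsub>C\<^esub> x i) \<odot>\<^bsub>F\<^esub> G)" by simp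
    also have "\<dots> = c i \<odot>\<^bsub>F\<^esub> t i \<oplus>\<^bsub>F\<^esub> (c i \<otimes>\<^bsub>C\<^esub> (\<phi> (a i) \<otimes>\<^bsub>C\<^esub> x i)) \<odot>\<^bsub>F\<^esub> G"
      using i by (simp add: F.smult_r_distr F.smult_assoc1)
    finally show "c i \<odot>\<^bsub>F\<^esub> e i = c i \<odot>\<^bsub>F\<^esub> t i \<oplus>\<^bsub>F\<^esub> x i [^]\<^bsub>C\<^esub> p i \<odot>\<^bsub>F\<^esub> G"
      using i by (simp only: c_inverse)
  qed auto
  also have "\<dots> = ?z \<oplus>\<^bsub>F\<^esub> (\<Oplus>\<^bsub>F\<^esub>i\<in>I. x i [^]\<^bsub>C\<^esub> p i \<odot>\<^bsub>F\<^esub> G)"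
    by (intro F.M.finsum_addf) auto
  also have "(\<Oplus>\<^bsub>F\<^esub>i\<in>I. x i [^]\<^bsub>C\<^esub> p i \<odot>\<^bsub>F\<^esub> G) = G"
    by (subst F.finsum_smult_rdistr[symmetric]) (auto simp: sum_pow)
  finally have "?z \<oplus>\<^bsub>F\<^esub> G = G" ..
  then show ?thesis using z by (simp add: F.M.add.r_cancel_one)
qed

lemma splitting_exists: "\<exists>s. s \<in> S"
proof -
  obtain D where D: "derivation P C q F D" and DX: "\<And>i. i \<in> I \<Longrightarrow> D (indet i) = t i"
    and D_const: "\<And>r. r \<in> carrier R \<Longrightarrow> D (R.indexed_const r) = \<zero>\<^bsub>F\<^esub>"
    using R.derivation_mpoly_exists[OF q.ring_hom_cring_axioms F.module_axioms fin, of t] t_closed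
    by blast
  interpret D: derivation P C q F D by (rule D)
  have "D H = (\<Oplus>\<^bsub>F\<^esub>i\<in>I. c i \<odot>\<^bsub>F\<^esub> t i)"
    unfolding derivation_H[OF D]
    by (intro F.M.add.finprod_cong') (auto simp: DX c_closed t_closed)
  then have DH: "D H = \<zero>\<^bsub>F\<^esub>" by (simp only: relation_t)
  \<comment> \<open>For f = g H the product rule gives q(g) D(H) + q(H) D(g). Both terms vanish, the
    first by \<open>DH\<close> and the second by \<open>q_H\<close>.\<close>
  have "D f = \<zero>\<^bsub>F\<^esub>" if f: "f \<in> carrier P" "q f = \<zero>\<^bsub>C\<^esub>" for f
  proof -
    obtain g where g: "g \<in> carrier P" "f = g \<otimes>\<^bsub>P\<^esub> H" using f q_ker by blast
    then show ?thesis by (simp add: D.D_mult H_closed DH q_H D.D_closed)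
  qed
  then obtain D' where D': "\<And>f. f \<in> carrier P \<Longrightarrow> D' (q f) = D f"
    using D.factor by blast
  obtain s where s: "s \<in> module_homs C \<Omega> F" "\<And>b. b \<in> carrier C \<Longrightarrow> s (d b) = D' b"
  \<comment> \<open>D' is known only at values of q, so each law is checked at preimages, which
    exist because q is onto, and transported from D.\<close>
  proof (rule K.kaehler_lift[OF F.module_axioms])
    show "D' b \<in> carrier F" if "b \<in> carrier C" for b
      using that unfolding q_surj by (auto simp: D' D.D_closed)
    show "D' (b \<oplus>\<^bsub>C\<^esub> b') = D' b \<oplus>\<^bsub>F\<^esub> D' b'" if b: "b \<in> carrier C" "b' \<in> carrier C" for b b'
    proof -
      obtain f g where "f \<in> carrier P" "b = q f" "g \<in> carrier P" "b' = q g"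
        using b q_surj by blast
      then show ?thesis using D'[of "f \<oplus>\<^bsub>P\<^esub> g"] by (simp add: D' D.D_add)
    qed
    show "D' (b \<otimes>\<^bsub>C\<^esub> b') = b \<odot>\<^bsub>F\<^esub> D' b' \<oplus>\<^bsub>F\<^esub> b' \<odot>\<^bsub>F\<^esub> D' b"
      if b: "b \<in> carrier C" "b' \<in> carrier C" for b b'
    proof -
      obtain f g where "f \<in> carrier P" "b = q f" "g \<in> carrier P" "b' = q g"
        using b q_surj by blast
      then show ?thesis using D'[of "f \<otimes>\<^bsub>P\<^esub> g"] by (simp add: D' D.D_mult)
    qed
    show "D' (\<phi> r) = \<zero>\<^bsub>F\<^esub>" if "r \<in> carrier R" for r
      using that by (simp add: \<phi>_def D' R.indexed_const_closed D_const)
  qed blast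
  have "s (w i) = t i" if "i \<in> I" for i
    using that s(2)[OF x_closed] by (simp add: w_def x_def D' indet_closed DX)
  then show ?thesis using s(1) by blast
qed

text \<open>Agreement on the carrier follows from the values at the generators w i. Extensionality,
  part of membership in \<open>module_homs\<close>, fixes both maps outside the carrier and turns
  agreement into equality of functions.\<close>

lemma splitting_unique:
  assumes "s \<in> S" "s' \<in> S"
  shows "s = s'"
proof (rule extensionalityI)
  have hom: "module_hom C \<Omega> F s" "module_hom C \<Omega> F s'"
    "s \<in> extensional (carrier \<Omega>)" "s' \<in> extensional (carrier \<Omega>)"
    using assms by (auto simp: module_homs_iff[OF K.module_kaehler F.module_axioms])
  then show "s \<in> extensional (carrier \<Omega>)" "s' \<in> extensional (carrier \<Omega>)" by auto
  show "s u = s' u" if "u \<in> carrier \<Omega>" for u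
    by (rule hom_eqI[OF hom(1,2) _ that]) (use assms in auto)
qed

section \<open>Recovering an element from its coordinates, and the connection\<close>

lemma splitting_sum:
  assumes s: "s \<in> S" and u: "u \<in> carrier \<Omega>"
  shows "u = (\<Oplus>\<^bsub>\<Omega>\<^esub>i\<in>I. s u i \<odot>\<^bsub>\<Omega>\<^esub> w i)"
proof -
  interpret s: module_hom C \<Omega> F s
    using s by (auto simp: module_homs_iff[OF K.module_kaehler F.module_axioms])
  \<comment> \<open>Elements of F are coefficient functions, so r can be given by its coordinate
    sum. Linearity and the values at the e i are verified afterwards.\<close>
  define r where "r = (\<lambda>f. \<Oplus>\<^bsub>\<Omega>\<^esub>i\<in>I. f i \<odot>\<^bsub>\<Omega>\<^esub> w i)"
  note [simp] = q.S.free_module_apply_closed[where S = I] w_closed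
  interpret r: module_hom C F \<Omega> r
  proof
    fix f assume f [simp]: "f \<in> carrier F"
    show "r f \<in> carrier \<Omega>" unfolding r_def by (intro K.\<Omega>.M.finsum_closed) auto
    show "r (b \<odot>\<^bsub>F\<^esub> f) = b \<odot>\<^bsub>\<Omega>\<^esub> r f" if [simp]: "b \<in> carrier C" for b
    proof -
      have "r (b \<odot>\<^bsub>F\<^esub> f) = (\<Oplus>\<^bsub>\<Omega>\<^esub>i\<in>I. b \<odot>\<^bsub>\<Omega>\<^esub> (f i \<odot>\<^bsub>\<Omega>\<^esub> w i))"
        unfolding r_def q.S.free_module_simps(4)
        by (intro K.\<Omega>.M.add.finprod_cong') (simp_all add: K.\<Omega>.smult_assoc1)
      also have "\<dots> = b \<odot>\<^bsub>\<Omega>\<^esub> r f"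
        unfolding r_def using fin by (intro K.\<Omega>.finsum_smult_ldistr[symmetric]) auto
      finally show ?thesis .
    qed
    show "r (f \<oplus>\<^bsub>F\<^esub> g) = r f \<oplus>\<^bsub>\<Omega>\<^esub> r g" if [simp]: "g \<in> carrier F" for g
    proof -
      have "r (f \<oplus>\<^bsub>F\<^esub> g) = (\<Oplus>\<^bsub>\<Omega>\<^esub>i\<in>I. f i \<odot>\<^bsub>\<Omega>\<^esub> w i \<oplus>\<^bsub>\<Omega>\<^esub> g i \<odot>\<^bsub>\<Omega>\<^esub> w i)"
        unfolding r_def q.S.free_module_simps(3)
        by (intro K.\<Omega>.M.add.finprod_cong') (simp_all add: K.\<Omega>.smult_l_distr)
      also have "\<dots> = r f \<oplus>\<^bsub>\<Omega>\<^esub> r g"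
        unfolding r_def by (intro K.\<Omega>.M.finsum_addf) auto
      finally show ?thesis .
    qed
  qed
  have re: "r (e i) = w i" if i: "i \<in> I" for i
  proof -
    have "r (e i) = (\<Oplus>\<^bsub>\<Omega>\<^esub>j\<in>I. if j = i then w j else \<zero>\<^bsub>\<Omega>\<^esub>)"
      unfolding r_def by (intro K.\<Omega>.M.add.finprod_cong') (auto simp: free_basis_def)
    also have "\<dots> = w i"
      using i fin by (intro K.\<Omega>.M.add.finprod_singleton_swap) auto
    finally show ?thesis .
  qed
  have "r G = (\<Oplus>\<^bsub>\<Omega>\<^esub>i\<in>I. r (c i \<odot>\<^bsub>F\<^esub> e i))"
    unfolding G_def by (rule r.hom_finsum) (auto simp: c_closed e_closed)
  also have "\<dots> = (\<Oplus>\<^bsub>\<Omega>\<^esub>i\<in>I. c i \<odot>\<^bsub>\<Omega>\<^esub> w i)"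
    by (intro K.\<Omega>.M.add.finprod_cong') (auto simp: c_closed e_closed r.hom_smult re)
  finally have rG: "r G = \<zero>\<^bsub>\<Omega>\<^esub>" by (simp only: relation_w)
  have rt: "r (t i) = w i" if i: "i \<in> I" for i
  proof -
    have "r (t i) = w i \<ominus>\<^bsub>\<Omega>\<^esub> \<zero>\<^bsub>\<Omega>\<^esub>"
      using i by (simp add: t_def r.hom_minus r.hom_smult re rG e_closed G_closed a_closed
          \<phi>_closed x_closed)
    then show ?thesis using i by (simp add: a_minus_def)
  qed
  have "module_hom C \<Omega> \<Omega> (\<lambda>u. r (s u))"
    by unfold_locales
      (auto simp: s.hom_closed r.hom_closed s.hom_add r.hom_add s.hom_smult r.hom_smult)
  moreover have "module_hom C \<Omega> \<Omega> (\<lambda>u. u)" by unfold_locales auto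
  \<comment> \<open>Two endomorphisms of \<Omega> are compared, r o s and the identity, so agreement
    at the w i is enough.\<close>
  ultimately have "r (s u) = u"
    by (rule hom_eqI) (use s rt u in auto)
  then show ?thesis by (simp only: r_def)
qed

lemma connection:
  assumes s: "s \<in> S"
  shows "is_connection C \<Omega> d
    (\<lambda>u. \<Oplus>\<^bsub>tensor_module C \<Omega> \<Omega>\<^esub>i\<in>I. pure_tensor C \<Omega> \<Omega> (d (s u i)) (w i))"
proof -
  interpret s: module_hom C \<Omega> F s
    using s by (auto simp: module_homs_iff[OF K.module_kaehler F.module_axioms])
  interpret T: tensor_product C \<Omega> \<Omega>
    by (simp add: tensor_product_def K.module_kaehler)
  define nab where "nab = (\<lambda>u. \<Oplus>\<^bsub>T.T\<^esub>i\<in>I. T.tensor (d (s u i)) (w i))"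
  have s_closed [simp]: "s u i \<in> carrier C" if "u \<in> carrier \<Omega>" for u i
    using q.S.free_module_apply_closed[OF s.hom_closed[OF that]] .
  note [simp] = w_closed K.d_closed T.tensor_closed
  have nab_closed: "nab u \<in> carrier T.T" if "u \<in> carrier \<Omega>" for u
    unfolding nab_def using that by (intro T.T.M.finsum_closed) auto
  have nab_add: "nab (u \<oplus>\<^bsub>\<Omega>\<^esub> v) = nab u \<oplus>\<^bsub>T.T\<^esub> nab v"
    if [simp]: "u \<in> carrier \<Omega>" "v \<in> carrier \<Omega>" for u v
  proof -
    have "nab (u \<oplus>\<^bsub>\<Omega>\<^esub> v)
        = (\<Oplus>\<^bsub>T.T\<^esub>i\<in>I. T.tensor (d (s u i)) (w i) \<oplus>\<^bsub>T.T\<^esub> T.tensor (d (s v i)) (w i))"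
      unfolding nab_def
      by (intro T.T.M.add.finprod_cong')
        (auto simp: s.hom_add q.S.free_module_simps(3) K.d_add T.tensor_add_left)
    also have "\<dots> = nab u \<oplus>\<^bsub>T.T\<^esub> nab v"
      unfolding nab_def by (intro T.T.M.finsum_addf) auto
    finally show ?thesis .
  qed
  have nab_smult: "nab (b \<odot>\<^bsub>\<Omega>\<^esub> u) = b \<odot>\<^bsub>T.T\<^esub> nab u \<oplus>\<^bsub>T.T\<^esub> T.tensor (d b) u"
    if [simp]: "b \<in> carrier C" "u \<in> carrier \<Omega>" for b u
  proof -
    \<comment> \<open>For fixed b, tensoring on the left with \<open>d b\<close> is C-linear. This
      later brings the sum of the surplus terms into the second factor.\<close>
    interpret Tb: module_hom C \<Omega> T.T "T.tensor (d b)" by (rule T.tensor_hom_right) simp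
    \<comment> \<open>Since s is linear, the coordinate of the multiple is b times
      \<open>s u i\<close>, and \<open>d_mult\<close> yields two terms. In the second, the scalar
      \<open>s u i\<close> leaves the left factor and enters the right one, by
      \<open>tensor_smult_left\<close> and \<open>tensor_smult_right\<close>.\<close>
    have "nab (b \<odot>\<^bsub>\<Omega>\<^esub> u) = (\<Oplus>\<^bsub>T.T\<^esub>i\<in>I. b \<odot>\<^bsub>T.T\<^esub> T.tensor (d (s u i)) (w i)
        \<oplus>\<^bsub>T.T\<^esub> T.tensor (d b) (s u i \<odot>\<^bsub>\<Omega>\<^esub> w i))"
      unfolding nab_def
      by (intro T.T.M.add.finprod_cong')
        (auto simp: s.hom_smult q.S.free_module_simps(4) K.d_mult T.tensor_add_left
          T.tensor_smult_left T.tensor_smult_right)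
    also have "\<dots> = (\<Oplus>\<^bsub>T.T\<^esub>i\<in>I. b \<odot>\<^bsub>T.T\<^esub> T.tensor (d (s u i)) (w i))
        \<oplus>\<^bsub>T.T\<^esub> (\<Oplus>\<^bsub>T.T\<^esub>i\<in>I. T.tensor (d b) (s u i \<odot>\<^bsub>\<Omega>\<^esub> w i))"
      by (intro T.T.M.finsum_addf) auto
    also have "(\<Oplus>\<^bsub>T.T\<^esub>i\<in>I. b \<odot>\<^bsub>T.T\<^esub> T.tensor (d (s u i)) (w i)) = b \<odot>\<^bsub>T.T\<^esub> nab u"
      unfolding nab_def using fin by (intro T.T.finsum_smult_ldistr[symmetric]) auto
    also have "(\<Oplus>\<^bsub>T.T\<^esub>i\<in>I. T.tensor (d b) (s u i \<odot>\<^bsub>\<Omega>\<^esub> w i))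
        = T.tensor (d b) (\<Oplus>\<^bsub>\<Omega>\<^esub>i\<in>I. s u i \<odot>\<^bsub>\<Omega>\<^esub> w i)"
      by (intro Tb.hom_finsum[symmetric]) auto
    also have "(\<Oplus>\<^bsub>\<Omega>\<^esub>i\<in>I. s u i \<odot>\<^bsub>\<Omega>\<^esub> w i) = u"
      using splitting_sum[OF s] by simp
    finally show ?thesis .
  qed
  show ?thesis
    unfolding is_connection_def Let_def nab_def[symmetric]
    using nab_closed nab_add nab_smult by blast
qed

end

section \<open>Inverses of positive integers in a rational algebra\<close>

lemma (in algebra) nat_smult:
  "r \<in> carrier M \<Longrightarrow> [n] \<cdot>\<^bsub>R\<^esub> \<one>\<^bsub>R\<^esub> \<odot>\<^bsub>M\<^esub> r = [n] \<cdot>\<^bsub>M\<^esub> r" for n :: nat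
  by (induction n) (auto simp: smult_l_distr)

text \<open>By \<open>nat_smult\<close> the multiple [n] is scalar multiplication by the rational
  number n. The two scalars are then multiplied in the field of rationals, where n times its inverse
  is 1 because n is nonzero.\<close>

lemma rational_algebra_inverse:
  assumes "algebra (ring_of_type_algebra :: rat ring) A" "(n::nat) \<ge> 1"
  shows "[n] \<cdot>\<^bsub>A\<^esub> (inverse (of_nat n) \<odot>\<^bsub>A\<^esub> \<one>\<^bsub>A\<^esub>) = \<one>\<^bsub>A\<^esub>"
proof -
  interpret algebra "ring_of_type_algebra :: rat ring" A by fact
  let ?Q = "ring_of_type_algebra :: rat ring"
  have Q: "carrier ?Q = UNIV" "\<one>\<^bsub>?Q\<^esub> = 1" "u \<otimes>\<^bsub>?Q\<^esub> v = u * v" "u \<oplus>\<^bsub>?Q\<^esub> v = u + v"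
    "\<zero>\<^bsub>?Q\<^esub> = 0" for u v
    by (simp_all add: ring_of_type_algebra_def)
  have n: "[n] \<cdot>\<^bsub>?Q\<^esub> \<one>\<^bsub>?Q\<^esub> = of_nat n"
    by (induction n) (simp_all add: Q)
  have "[n] \<cdot>\<^bsub>A\<^esub> (inverse (of_nat n) \<odot>\<^bsub>A\<^esub> \<one>\<^bsub>A\<^esub>)
      = of_nat n \<odot>\<^bsub>A\<^esub> (inverse (of_nat n) \<odot>\<^bsub>A\<^esub> \<one>\<^bsub>A\<^esub>)"
    using nat_smult[of "inverse (of_nat n) \<odot>\<^bsub>A\<^esub> \<one>\<^bsub>A\<^esub>" n] by (simp add: n Q(1))
  also have "\<dots> = (of_nat n * inverse (of_nat n)) \<odot>\<^bsub>A\<^esub> \<one>\<^bsub>A\<^esub>"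
    using smult_assoc1[of "of_nat n" "inverse (of_nat n)" "\<one>\<^bsub>A\<^esub>"] by (simp add: Q(1,3))
  also have "\<dots> = 1 \<odot>\<^bsub>A\<^esub> \<one>\<^bsub>A\<^esub>" using assms(2) by simp
  also have "\<dots> = \<one>\<^bsub>A\<^esub>" using smult_one[of "\<one>\<^bsub>A\<^esub>"] by (simp add: Q(2))
  finally show ?thesis .
qed

theorem theorem4p2:
  fixes A :: "(rat, 'a, 'm) module_scheme"
    and k :: nat and p :: "nat \<Rightarrow> nat"
    and P :: "(nat multiset \<Rightarrow> 'a) ring"
    and H :: "nat multiset \<Rightarrow> 'a"
    and J :: "(nat multiset \<Rightarrow> 'a) set"
    and C :: "(nat multiset \<Rightarrow> 'a) set ring"
    and \<phi> :: "'a \<Rightarrow> (nat multiset \<Rightarrow> 'a) set"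
    and x :: "nat \<Rightarrow> (nat multiset \<Rightarrow> 'a) set"
  assumes A: "algebra (ring_of_type_algebra :: rat ring) A"
    and k: "k \<ge> 1"
    and p: "\<And>i. i \<in> {1..k} \<Longrightarrow> p i \<ge> 1"
    and P: "P = mpoly_ring A {1..k}"
    and H: "H = (\<Oplus>\<^bsub>P\<^esub>i\<in>{1..k}. ring.indexed_var A i [^]\<^bsub>P\<^esub> p i) \<ominus>\<^bsub>P\<^esub> \<one>\<^bsub>P\<^esub>"
    and J: "J = PIdl\<^bsub>P\<^esub> H"
    and C: "C = P Quot J"
    and \<phi>: "\<phi> = (\<lambda>a. J +>\<^bsub>P\<^esub> ring.indexed_const A a)"
    and x: "x = (\<lambda>i. J +>\<^bsub>P\<^esub> ring.indexed_var A i)"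
    and \<Omega>: "\<Omega> = kaehler A C \<phi>"
    and d: "d = kaehler_d A C \<phi>"
    and w: "w = (\<lambda>i. d (x i))"
    and F: "F = free_module C {1..k}"
    and e: "e = (\<lambda>i. free_basis C i)"
    and G: "G = (\<Oplus>\<^bsub>F\<^esub>i\<in>{1..k}. ([p i] \<cdot>\<^bsub>C\<^esub> (x i [^]\<^bsub>C\<^esub> (p i - 1))) \<odot>\<^bsub>F\<^esub> e i)"
    and S: "S = {s \<in> module_homs C \<Omega> F. \<forall>i\<in>{1..k}.
               s (w i) = e i \<ominus>\<^bsub>F\<^esub> (\<phi> (inverse (of_nat (p i)) \<odot>\<^bsub>A\<^esub> \<one>\<^bsub>A\<^esub>) \<otimes>\<^bsub>C\<^esub> x i) \<odot>\<^bsub>F\<^esub> G}"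
  shows "(\<exists>!s. s \<in> S) \<and>
         (\<forall>s\<in>S. let \<xi> = (\<lambda>i u. s u i) in
            is_connection C \<Omega> d
              (\<lambda>u. \<Oplus>\<^bsub>tensor_module C \<Omega> \<Omega>\<^esub>i\<in>{1..k}. pure_tensor C \<Omega> \<Omega> (d (\<xi> i u)) (w i)))"
proof -
  interpret A: algebra "ring_of_type_algebra :: rat ring" A by (rule A)
  interpret P: cring P unfolding P by (rule A.cring_mpoly_ring)
  have HP: "H \<in> carrier P"
    unfolding H P[symmetric]
    by (intro P.minus_closed P.finsum_closed P.one_closed)
      (auto simp: P intro!: monoid.nat_pow_closed A.indexed_var_closed
        cring.cring_simprules ring.is_monoid cring.axioms A.cring_mpoly_ring)
  let ?q = "\<lambda>f. J +>\<^bsub>P\<^esub> f"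
  have quot: "ring_hom_cring P C ?q" "carrier C = ?q ` carrier P"
    "\<And>f. f \<in> carrier P \<Longrightarrow> ?q f = \<zero>\<^bsub>C\<^esub> \<longleftrightarrow> (\<exists>g\<in>carrier P. f = g \<otimes>\<^bsub>P\<^esub> H)"
    using P.principal_quotient[OF HP] unfolding C J by auto
  \<comment> \<open>The family a is instantiated by the images of 1/p_i in the algebra;
    \<open>rational_algebra_inverse\<close> verifies that they invert p_i.\<close>
  interpret fq: fermat_quotient A "{1..k}" C ?q p "\<lambda>i. inverse (of_nat (p i)) \<odot>\<^bsub>A\<^esub> \<one>\<^bsub>A\<^esub>" H
    unfolding fermat_quotient_def fermat_quotient_axioms_def
    using quot p rational_algebra_inverse[OF A] H A.M_cring
    by (auto simp: P ring_of_type_algebra_def intro!: A.smult_closed)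
  have \<phi>': "fq.\<phi> = \<phi>" by (simp add: fq.\<phi>_def \<phi>)
  have x': "fq.x = x" by (simp add: fq.x_def x)
  have w': "fq.w = w" by (simp add: fq.w_def w d x' \<phi>')
  have G': "fq.G = G" by (simp only: fq.G_def fq.c_def G F e x')
  have S': "S = {s \<in> module_homs C (kaehler A C fq.\<phi>) (free_module C {1..k}).
      \<forall>i\<in>{1..k}. s (fq.w i) = fq.t i}"
    by (simp only: S fq.t_def w' G' x' \<phi>' F e \<Omega>)
  have "\<exists>!s. s \<in> S"
    unfolding S' using fq.splitting_exists fq.splitting_unique by blast
  moreover have "is_connection C \<Omega> d
      (\<lambda>u. \<Oplus>\<^bsub>tensor_module C \<Omega> \<Omega>\<^esub>i\<in>{1..k}. pure_tensor C \<Omega> \<Omega> (d (s u i)) (w i))"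
    if "s \<in> S" for s
    using fq.connection[OF that[unfolded S']] by (simp only: w' \<phi>' \<Omega> d)
  \<comment> \<open>The coordinate function e_i^* is evaluation at i, so \<open>\<xi> i u\<close>
    unfolds to \<open>s u i\<close>.\<close>
  ultimately show ?thesis by (simp add: Let_def)
qed

end
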